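(* Let $n,m$ be positive integers with $m\le 2^{-4}n$. Let $G$ be an abelian group and $Y\subseteq G$ with $|Y|=n$. Let $\mathcal{F}^{\mathrm{asym}}_Y(m)$ be the family of pairs $(A,B)$ of subsets of $Y$ with $|A+B|\le m$. Then \[|\mathcal{F}^{\mathrm{asym}}_Y(m)|\le n^{6\sqrt m}\binom{n}{\le m}.\] Furthermore, let $s\ge\sqrt m$ be an integer and let $\mathcal{F}^{\mathrm{asym}}_Y(m,\ge s)$ be the family of pairs $(A,B)\in\mathcal{F}^{\mathrm{asym}}_Y(m)$ with $|A|,|B|\ge s$. Then \[|\mathcal{F}^{\mathrm{asym}}_Y(m,\ge s)|\le\begin{cases}n^{(4+6\alpha)\sqrt m}&\text{if } m\le(\log n)^2,\\ 2^{(1+2^{13}\alpha^{-2/3})(m+\beta)}&\text{if } m>(\log n)^2,\end{cases}\] where $\alpha=\left(\frac{\sqrt m}{\log n}\right)^{1/2}$ and $\beta=\beta_G\big(m+\alpha^{-2/3}m\big)$.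
   Context: $\binom{n}{\le m}=\sum_{k=0}^{m}\binom{n}{k}$. $A+B=\{a+b:a\in A,b\in B\}$. For an abelian group $G$ and real $x>0$, $\beta_G(x)$ denotes the largest size of a subgroup $H\le G$ with $|H|\le x$. Logarithms are base $2$.
   Formalization: The family of pairs (A,B) is restricted to nonempty subsets A, B of Y; with empty sets allowed every pair (A,∅) has |A+B|=0, giving at least 2^n pairs, so the first bound fails (e.g. m=1, n=1000). The second bound is unaffected. *)

theory Defs
  imports Complex_Main "HOL-Algebra.Coset"
begin

text \<open>
  Abelian groups are commutative groups in the sense of \<^locale>\<open>comm_group\<close>, written
  multiplicatively; the sumset \<open>A + B\<close> is the library's \<open>A <#>\<^bsub>G\<^esub> B\<close>.
\<close>

definition binom_le :: "nat \<Rightarrow> nat \<Rightarrow> nat" where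
  "binom_le n m = (\<Sum>k=0..m. n choose k)"

text \<open>
  Finiteness is stated explicitly because \<^const>\<open>card\<close> is \<open>0\<close> on infinite sets.
  For \<open>x \<ge> 1\<close> the trivial subgroup qualifies and the maximum exists.
\<close>
definition subgroup_beta :: "('a, 'b) monoid_scheme \<Rightarrow> real \<Rightarrow> nat" where
  "subgroup_beta G x = Max {card H | H. subgroup H G \<and> finite H \<and> real (card H) \<le> x}"

text \<open>
  The sets are taken nonempty: if \<open>B\<close> is empty then so is \<open>A + B\<close>, and admitting these
  degenerate pairs would add more than \<open>2 ^ card Y\<close> members to the family for every \<open>m\<close>.
\<close>
definition F_asym :: "('a, 'b) monoid_scheme \<Rightarrow> 'a set \<Rightarrow> nat \<Rightarrow> ('a set \<times> 'a set) set" where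
  "F_asym G Y m =
     {(A, B). A \<subseteq> Y \<and> B \<subseteq> Y \<and> A \<noteq> {} \<and> B \<noteq> {} \<and> card (A <#>\<^bsub>G\<^esub> B) \<le> m}"

definition F_asym_ge ::
  "('a, 'b) monoid_scheme \<Rightarrow> 'a set \<Rightarrow> nat \<Rightarrow> nat \<Rightarrow> ('a set \<times> 'a set) set" where
  "F_asym_ge G Y m s = {(A, B) \<in> F_asym G Y m. card A \<ge> s \<and> card B \<ge> s}"

end

theory Submission
  imports Defs
begin

text \<open>
  The pairs are counted by containers. If \<open>|A|, |B| \<ge> k\<close>, fix \<open>F \<subseteq> A\<close> and \<open>F' \<subseteq> B\<close> of size
  \<open>k\<close>, about \<open>sqrt m\<close>, and add translates \<open>F b\<close>, \<open>a F'\<close> with \<open>a \<in> A\<close>, \<open>b \<in> B\<close> to a set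
  \<open>Q \<subseteq> A B\<close> as long as each brings at least \<open>\<delta>\<close> new elements. As \<open>|Q| \<le> m\<close>, at most \<open>m / \<delta>\<close>
  translates are added, and at the end \<open>A\<close> and \<open>B\<close> lie in the sets of those \<open>y\<close> whose translate
  has fewer than \<open>\<delta>\<close> elements outside \<open>Q\<close>; by double counting these have size at most
  \<open>k m / (k - \<delta>)\<close>. Taking \<open>\<delta> = k / 2\<close> gives the first bound and the second one for small \<open>m\<close>.

  For large \<open>m\<close> the total size of the two containers has to come down from \<open>2 m\<close> to
  \<open>(1 + O(\<epsilon>)) (m + \<beta>)\<close>, where \<open>\<epsilon> = \<alpha> powr (- 2 / 3)\<close>. While it is larger, a Pollard-type version
  of Kneser's theorem yields of the order of \<open>\<epsilon>\<^sup>2 m\<^sup>2\<close> pairs whose product lies outside \<open>Q\<close>, and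
  recording about \<open>sqrt m\<close> further elements shrinks a container or enlarges \<open>Q\<close> by a multiple of
  \<open>\<epsilon>\<^sup>2 m\<close>. So \<open>O(sqrt m / \<epsilon>\<^sup>2)\<close> elements are recorded, at a cost of
  \<open>O(sqrt m * log n / \<epsilon>\<^sup>2) = O(\<epsilon> m)\<close> bits.
\<close>

section \<open>Greedy covers and weighted subset counts\<close>

text \<open>Choose \<open>Z\<close> maximal under inclusion among the index sets whose members gain
  at least \<open>\<delta>\<close> each on average. An index with at least \<open>\<delta>\<close>
  elements of \<open>S j\<close> still uncovered could be added to it.\<close>

lemma greedy_cover:
  fixes S :: "'i \<Rightarrow> 'b set" and \<delta> :: real
  assumes "finite J" and fin: "\<And>j. j \<in> J \<Longrightarrow> finite (S j)" and "finite P" and "\<delta> > 0"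
  obtains Z where "Z \<subseteq> J"
    and "\<delta> * card Z \<le> real (card (P \<union> (\<Union>j\<in>Z. S j))) - real (card P)"
    and "\<And>j. j \<in> J \<Longrightarrow> real (card (S j - (P \<union> (\<Union>j\<in>Z. S j)))) < \<delta>"
proof -
  define Q where "Q Z = P \<union> (\<Union>j\<in>Z. S j)" for Z
  define \<Z> where "\<Z> = {Z. Z \<subseteq> J \<and> \<delta> * card Z \<le> real (card (Q Z)) - real (card P)}"
  have finQ: "finite (Q Z)" if "Z \<subseteq> J" for Z
    unfolding Q_def using that assms(1,3) fin by (auto intro: finite_subset)
  have "finite \<Z>" unfolding \<Z>_def using assms(1) by (auto intro: finite_subset[of _ "Pow J"])
  moreover have "{} \<in> \<Z>" unfolding \<Z>_def Q_def by simp
  ultimately obtain Z where Z: "Z \<in> \<Z>" and max: "\<And>Z'. Z' \<in> \<Z> \<Longrightarrow> Z \<subseteq> Z' \<Longrightarrow> Z = Z'"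
    by (metis finite_has_maximal2)
  have ZJ: "Z \<subseteq> J" and Zc: "\<delta> * card Z \<le> real (card (Q Z)) - real (card P)"
    using Z unfolding \<Z>_def by auto
  have "real (card (S j - Q Z)) < \<delta>" if j: "j \<in> J" for j
  proof (rule ccontr)
    assume "\<not> ?thesis"
    then have ge: "real (card (S j - Q Z)) \<ge> \<delta>" by simp
    have jZ: "j \<notin> Z"
    proof
      assume "j \<in> Z"
      then have "S j - Q Z = {}" unfolding Q_def by auto
      then have "card (S j - Q Z) = 0" by (metis card.empty)
      then show False using ge \<open>\<delta> > 0\<close> by simp
    qed
    have "Q (insert j Z) = Q Z \<union> (S j - Q Z)" unfolding Q_def by auto
    then have "card (Q (insert j Z)) = card (Q Z) + card (S j - Q Z)"
      using finQ[OF ZJ] fin[OF j] by (metis Diff_disjoint card_Un_disjoint finite_Diff)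
    moreover have "card (insert j Z) = Suc (card Z)"
      using jZ ZJ assms(1) by (meson card_insert_disjoint finite_subset)
    ultimately have "insert j Z \<in> \<Z>" unfolding \<Z>_def using ZJ j Zc ge by (simp add: algebra_simps)
    then show False using max[of "insert j Z"] jZ by blast
  qed
  then show ?thesis using that[OF ZJ] Zc unfolding Q_def by blast
qed

lemma sum_Pow_power_card:
  fixes x :: "'c::comm_semiring_1"
  assumes "finite J"
  shows "(\<Sum>F\<in>Pow J. x ^ card F) = (1 + x) ^ card J"
  using assms
proof (induction J rule: finite_induct)
  case (insert j J)
  have "(\<Sum>F\<in>Pow (insert j J). x ^ card F)
      = (\<Sum>F\<in>Pow J. x ^ card F) + (\<Sum>F\<in>insert j ` Pow J. x ^ card F)"
    unfolding Pow_insert using insert by (intro sum.union_disjoint) auto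
  also have "(\<Sum>F\<in>insert j ` Pow J. x ^ card F) = (\<Sum>F\<in>Pow J. x ^ card (insert j F))"
    using insert by (intro sum.reindex_cong[of "insert j"]) (auto simp: inj_on_def)
  also have "\<dots> = (\<Sum>F\<in>Pow J. x * x ^ card F)"
  proof (intro sum.cong refl)
    fix F assume "F \<in> Pow J"
    then have "finite F" "j \<notin> F" using insert by (auto intro: finite_subset)
    then show "x ^ card (insert j F) = x * x ^ card F" by simp
  qed
  finally show ?case using insert by (simp add: sum_distrib_left[symmetric] algebra_simps)
qed simp

text \<open>This is the device for summing over recorded sets of all sizes at once: with a factor
  \<open>n\<close> charged per element, all subsets of an \<open>n\<close>-element set together cost
  at most \<open>exp 1\<close>.\<close>

lemma sum_Pow_powr_card_le:
  fixes n :: nat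
  assumes "finite J" and "n > 0"
  shows "(\<Sum>F\<in>Pow J. real n powr (- real (card F))) \<le> exp (card J / n)"
proof -
  have "(\<Sum>F\<in>Pow J. real n powr (- real (card F))) = (\<Sum>F\<in>Pow J. (1 / n) ^ card F)"
    using assms by (intro sum.cong) (auto simp: powr_minus powr_realpow power_divide inverse_eq_divide)
  also have "\<dots> = (1 + 1 / n) ^ card J" by (rule sum_Pow_power_card[OF assms(1)])
  also have "\<dots> \<le> exp (1 / n) ^ card J" by (intro power_mono) (auto simp: add_nonneg_nonneg)
  also have "\<dots> = exp (card J / n)" by (simp flip: exp_of_nat_mult)
  finally show ?thesis .
qed

section \<open>Truncated representation sums\<close>

context comm_group
begin

definition rep :: "'a set \<Rightarrow> 'a set \<Rightarrow> 'a \<Rightarrow> nat" where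
  "rep U V x = card {(u, v). u \<in> U \<and> v \<in> V \<and> u \<otimes> v = x}"

text \<open>The quantity of Pollard's theorem: for finite sets it is the sum over i = 1, ...,
  \<open>t\<close> of the number of elements with at least i representations. For
  \<open>t = 1\<close> it is the size of the product set.\<close>

definition trunc_sum :: "'a set \<Rightarrow> 'a set \<Rightarrow> nat \<Rightarrow> nat" where
  "trunc_sum U V t = (\<Sum>x\<in>U <#> V. min (rep U V x) t)"

lemma finite_set_mult: "finite U \<Longrightarrow> finite V \<Longrightarrow> finite (U <#> V)"
  unfolding set_mult_def by auto

lemma set_mult_memI: "u \<in> U \<Longrightarrow> v \<in> V \<Longrightarrow> u \<otimes> v \<in> U <#> V"
  unfolding set_mult_def by auto

lemma finite_rep_pairs:
  "finite U \<Longrightarrow> finite V \<Longrightarrow> finite {(u, v). u \<in> U \<and> v \<in> V \<and> u \<otimes> v = x}"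
  by (rule finite_subset[of _ "U \<times> V"]) auto

lemma rep_eq_0: "x \<notin> U <#> V \<Longrightarrow> rep U V x = 0"
proof -
  assume "x \<notin> U <#> V"
  then have "{(u, v). u \<in> U \<and> v \<in> V \<and> u \<otimes> v = x} = {}" using set_mult_memI by auto
  then show ?thesis unfolding rep_def by (metis card.empty)
qed

lemma trunc_sum_superset:
  assumes "finite X" and "U <#> V \<subseteq> X"
  shows "trunc_sum U V t = (\<Sum>x\<in>X. min (rep U V x) t)"
  unfolding trunc_sum_def using assms by (intro sum.mono_neutral_left) (auto simp: rep_eq_0)

lemma sum_rep:
  assumes "finite U" and "finite V" and "finite X"
  shows "(\<Sum>x\<in>X. rep U V x) = card {(u, v). u \<in> U \<and> v \<in> V \<and> u \<otimes> v \<in> X}"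
proof -
  have "{(u, v). u \<in> U \<and> v \<in> V \<and> u \<otimes> v \<in> X} = (\<Union>x\<in>X. {(u, v). u \<in> U \<and> v \<in> V \<and> u \<otimes> v = x})"
    by auto
  also have "card \<dots> = (\<Sum>x\<in>X. rep U V x)"
    unfolding rep_def using assms finite_rep_pairs by (intro card_UN_disjoint) auto
  finally show ?thesis by simp
qed

lemma rep_le_card_left:
  assumes "U \<subseteq> carrier G" and "V \<subseteq> carrier G" and "finite U"
  shows "rep U V x \<le> card U"
  unfolding rep_def
proof (rule card_inj_on_le[of fst])
  show "inj_on fst {(u, v). u \<in> U \<and> v \<in> V \<and> u \<otimes> v = x}"
    using assms by (auto simp: inj_on_def subset_iff)
qed (use assms in auto)

text \<open>Split the pairs by whether u lies in \<open>V\<close> and v in \<open>U\<close>.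
  Commutativity swaps the pairs in (U - V) x (U \<inter> V), which then complete (U \<inter> V) x V
  to (U \<inter> V) x (U \<union> V).\<close>

lemma rep_union_inter:
  assumes "finite U" and "finite V" and "U \<subseteq> carrier G" and "V \<subseteq> carrier G"
  shows "rep U V x = rep (U \<inter> V) (U \<union> V) x + rep (U - V) (V - U) x"
proof -
  let ?R = "\<lambda>U V. {(u, v). u \<in> U \<and> v \<in> V \<and> u \<otimes> v = x}"
  have fin: "finite (?R A B)" if "A \<subseteq> U \<union> V" "B \<subseteq> U \<union> V" for A B
    using assms that by (intro finite_rep_pairs) (auto intro: finite_subset[of _ "U \<union> V"])
  have "rep U V x = card (?R (U \<inter> V) V \<union> ?R (U - V) (U \<inter> V) \<union> ?R (U - V) (V - U))"
    unfolding rep_def by (rule arg_cong[of _ _ card]) auto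
  also have "\<dots> = card (?R (U \<inter> V) V) + card (?R (U - V) (U \<inter> V)) + rep (U - V) (V - U) x"
    unfolding rep_def
    by (subst card_Un_disjoint, (intro finite_UnI fin; blast), (intro finite_UnI fin; blast), blast)+ simp
  also have "card (?R (U - V) (U \<inter> V)) = card (?R (U \<inter> V) (U - V))"
    by (rule bij_betw_same_card[of prod.swap], rule bij_betwI[of _ _ _ prod.swap])
      (use assms in \<open>auto intro!: m_comm\<close>)
  also have "card (?R (U \<inter> V) V) + card (?R (U \<inter> V) (U - V)) = card (?R (U \<inter> V) V \<union> ?R (U \<inter> V) (U - V))"
    by (subst card_Un_disjoint; (intro fin)?; auto)
  also have "?R (U \<inter> V) V \<union> ?R (U \<inter> V) (U - V) = ?R (U \<inter> V) (U \<union> V)" by auto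
  finally show ?thesis unfolding rep_def by simp
qed

lemma trunc_sum_commute:
  assumes "U \<subseteq> carrier G" and "V \<subseteq> carrier G"
  shows "trunc_sum U V t = trunc_sum V U t"
proof -
  have "rep U V x = rep V U x" for x
    unfolding rep_def
    by (rule bij_betw_same_card[of prod.swap], rule bij_betwI[of _ _ _ prod.swap])
      (use assms in \<open>auto intro!: m_comm\<close>)
  moreover have "U <#> V = V <#> U"
    unfolding set_mult_def using assms m_comm by blast
  ultimately show ?thesis unfolding trunc_sum_def by simp
qed

lemma trunc_sum_translate:
  assumes "U \<subseteq> carrier G" and "V \<subseteq> carrier G" and e: "e \<in> carrier G"
  shows "trunc_sum U ((\<lambda>v. v \<otimes> e) ` V) t = trunc_sum U V t"
proof -
  have UV: "U <#> V \<subseteq> carrier G" using assms(1,2) unfolding set_mult_def by auto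
  have "rep U ((\<lambda>v. v \<otimes> e) ` V) (x \<otimes> e) = rep U V x" if "x \<in> carrier G" for x
    unfolding rep_def
  proof (rule bij_betw_same_card[symmetric], rule bij_betwI')
    let ?f = "\<lambda>(u, v). (u, v \<otimes> e)"
    fix p q assume "p \<in> {(u, v). u \<in> U \<and> v \<in> V \<and> u \<otimes> v = x}"
      "q \<in> {(u, v). u \<in> U \<and> v \<in> V \<and> u \<otimes> v = x}"
    then show "(?f p = ?f q) = (p = q)" using assms by (auto simp: subset_iff)
  next
    let ?f = "\<lambda>(u, v). (u, v \<otimes> e)"
    fix p assume "p \<in> {(u, v). u \<in> U \<and> v \<in> V \<and> u \<otimes> v = x}"
    then show "?f p \<in> {(u, v). u \<in> U \<and> v \<in> (\<lambda>v. v \<otimes> e) ` V \<and> u \<otimes> v = x \<otimes> e}"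
      using assms by (auto simp: subset_iff m_assoc)
  next
    fix p assume "p \<in> {(u, v). u \<in> U \<and> v \<in> (\<lambda>v. v \<otimes> e) ` V \<and> u \<otimes> v = x \<otimes> e}"
    then obtain u v where p: "p = (u, v \<otimes> e)" "u \<in> U" "v \<in> V" "u \<otimes> (v \<otimes> e) = x \<otimes> e" by auto
    then have "u \<otimes> v = x" using assms that by (auto simp: subset_iff simp flip: m_assoc)
    then show "\<exists>q\<in>{(u, v). u \<in> U \<and> v \<in> V \<and> u \<otimes> v = x}. p = (\<lambda>(u, v). (u, v \<otimes> e)) q"
      using p by auto
  qed
  moreover have "U <#> ((\<lambda>v. v \<otimes> e) ` V) = (\<lambda>x. x \<otimes> e) ` (U <#> V)"
    unfolding set_mult_def using assms by (force simp: subset_iff m_assoc image_iff)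
  moreover have "inj_on (\<lambda>x. x \<otimes> e) (U <#> V)"
    using UV e by (auto simp: inj_on_def subset_iff)
  ultimately show ?thesis
    unfolding trunc_sum_def using UV by (auto simp: sum.reindex intro!: sum.cong)
qed

text \<open>The one-sided condition is enough: an injective map of the finite set \<open>U\<close>
  into itself is onto, which gives closure under inverses.\<close>

lemma subgroup_stabilizer:
  assumes "finite U" and "U \<subseteq> carrier G"
  shows "subgroup {h \<in> carrier G. \<forall>u\<in>U. h \<otimes> u \<in> U} G"
proof (rule subgroup.intro)
  fix h assume h: "h \<in> {h \<in> carrier G. \<forall>u\<in>U. h \<otimes> u \<in> U}"
  have "inj_on ((\<otimes>) h) U" using h assms by (auto simp: inj_on_def subset_iff)
  then have "(\<otimes>) h ` U = U" using h assms by (intro endo_inj_surj) auto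
  then have "\<exists>u'\<in>U. u = h \<otimes> u'" if "u \<in> U" for u using that by auto
  then show "inv h \<in> {h \<in> carrier G. \<forall>u\<in>U. h \<otimes> u \<in> U}"
    using h assms by (fastforce simp: subset_iff simp flip: m_assoc)
qed (use assms in \<open>auto simp: subset_iff m_assoc\<close>)

text \<open>Each of the \<open>card U\<close> distinct elements \<open>u \<otimes> v0\<close> is
  also the product of \<open>u \<otimes> v0 \<otimes> inv v\<close> and \<open>v\<close>, for every
  \<open>v\<close> in \<open>V\<close>, so it has at least \<open>card V\<close>
  representations.\<close>

lemma trunc_sum_stable:
  assumes "finite U" and "finite V" and "U \<subseteq> carrier G" and "V \<subseteq> carrier G"
    and "v0 \<in> V" and "t \<le> card V"
    and stable: "\<And>u v. u \<in> U \<Longrightarrow> v \<in> V \<Longrightarrow> u \<otimes> v0 \<otimes> inv v \<in> U"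
  shows "t * card U \<le> trunc_sum U V t"
proof -
  have inj: "inj_on (\<lambda>u. u \<otimes> v0) U" using assms by (auto simp: inj_on_def subset_iff)
  have "t \<le> rep U V (u \<otimes> v0)" if u: "u \<in> U" for u
  proof -
    have "card V \<le> rep U V (u \<otimes> v0)"
      unfolding rep_def
    proof (rule card_inj_on_le[of "\<lambda>v. (u \<otimes> v0 \<otimes> inv v, v)"])
      show "(\<lambda>v. (u \<otimes> v0 \<otimes> inv v, v)) ` V \<subseteq> {(a, b). a \<in> U \<and> b \<in> V \<and> a \<otimes> b = u \<otimes> v0}"
        using stable u assms by (auto simp: subset_iff m_assoc)
    qed (use assms finite_rep_pairs in \<open>auto simp: inj_on_def\<close>)
    then show ?thesis using assms by simp
  qed
  then have "t * card U \<le> (\<Sum>u\<in>U. min (rep U V (u \<otimes> v0)) t)"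
    using sum_bounded_below[of U t "\<lambda>u. min (rep U V (u \<otimes> v0)) t"] by (simp add: mult.commute)
  also have "\<dots> = (\<Sum>x\<in>(\<lambda>u. u \<otimes> v0) ` U. min (rep U V x) t)"
    using inj by (simp add: sum.reindex)
  also have "\<dots> \<le> trunc_sum U V t"
    unfolding trunc_sum_def using assms finite_set_mult set_mult_memI by (intro sum_mono2) auto
  finally show ?thesis .
qed

text \<open>A Pollard-type form of Kneser's theorem. The transform \<open>(U, V) \<mapsto> (U \<union> Ve, U \<inter> Ve)\<close>
  is applied until every translate of \<open>V\<close> that meets \<open>U\<close> lies in \<open>U\<close>; then \<open>V\<close> lies in a
  coset of the stabiliser of \<open>U\<close>.\<close>

theorem pollard_kneser:
  fixes x \<beta> :: real
  assumes "finite U" and "finite V" and "U \<subseteq> carrier G" and "V \<subseteq> carrier G"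
    and "t \<le> card U" and "t \<le> card V" and "\<beta> \<ge> 0"
    and \<beta>: "\<And>H. subgroup H G \<Longrightarrow> finite H \<Longrightarrow> real (card H) \<le> x \<Longrightarrow> real (card H) \<le> \<beta>"
  shows "real t * min (real (card U) + real (card V) - real t - \<beta>) x \<le> real (trunc_sum U V t)"
  using assms(1-6)
\<comment> \<open>Both recursive calls have a smaller second set: the intersection \<open>I\<close>
  in one, the remainder \<open>V' - I\<close> in the other.\<close>
proof (induction "card V" arbitrary: U V t rule: less_induct)
  case less
  note fin = \<open>finite U\<close> \<open>finite V\<close> and sub = \<open>U \<subseteq> carrier G\<close> \<open>V \<subseteq> carrier G\<close>
  show ?case
  proof (cases "t = 0")
    case False
    then have "U \<noteq> {}" "V \<noteq> {}" using less.prems by auto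
    show ?thesis
    proof (cases "\<exists>e\<in>carrier G. U \<inter> (\<lambda>v. v \<otimes> e) ` V \<noteq> {} \<and> \<not> (\<lambda>v. v \<otimes> e) ` V \<subseteq> U")
      case True
      then obtain e where e: "e \<in> carrier G" and meets: "U \<inter> (\<lambda>v. v \<otimes> e) ` V \<noteq> {}"
        and proper: "\<not> (\<lambda>v. v \<otimes> e) ` V \<subseteq> U" by blast
      define V' where "V' = (\<lambda>v. v \<otimes> e) ` V"
      define I where "I = U \<inter> V'"
      define W where "W = U \<union> V'"
      have V': "finite V'" "V' \<subseteq> carrier G" unfolding V'_def using fin sub e by auto
      have "inj_on (\<lambda>v. v \<otimes> e) V" using sub e by (auto simp: inj_on_def subset_iff)
      then have cV': "card V' = card V" unfolding V'_def by (rule card_image)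
      have I: "finite I" "I \<subseteq> carrier G" "card I > 0" "I \<subseteq> U" "I \<subseteq> V'"
        unfolding I_def using fin sub V' meets V'_def by (auto simp: card_gt_0_iff)
      have W: "finite W" "W \<subseteq> carrier G" unfolding W_def using fin sub V' by auto
      have "I \<subset> V'" using proper unfolding I_def V'_def by auto
      then have cI: "card I < card V" using V' cV' psubset_card_mono by metis
      have cIW: "card I + card W = card U + card V"
        unfolding I_def W_def using card_Un_Int[of U V'] fin V' cV' by simp
      have tr: "trunc_sum U V t = trunc_sum U V' t"
        unfolding V'_def using trunc_sum_translate sub e by simp
      define X where "X = W <#> W"
      have X: "finite X" unfolding X_def using W finite_set_mult by simp
      have subX: "A <#> B \<subseteq> X" if "A \<subseteq> W" "B \<subseteq> W" for A B
        unfolding X_def using that by (auto simp: set_mult_def)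
      have split: "rep U V' y = rep I W y + rep (U - I) (V' - I) y" for y
        using rep_union_inter[OF fin(1) V'(1) sub(1) V'(2), of y]
        by (simp add: I_def W_def Diff_Int Int_commute)
      have TU: "trunc_sum U V' t = (\<Sum>y\<in>X. min (rep U V' y) t)"
        by (intro trunc_sum_superset X subX) (auto simp: W_def)
      have TI: "trunc_sum I W t' = (\<Sum>y\<in>X. min (rep I W y) t')" for t'
        by (intro trunc_sum_superset X subX) (auto simp: W_def I_def)
      have TD: "trunc_sum (U - I) (V' - I) t' = (\<Sum>y\<in>X. min (rep (U - I) (V' - I) y) t')" for t'
        by (intro trunc_sum_superset X subX) (auto simp: W_def I_def)
      show ?thesis
      proof (cases "t \<le> card I")
        case True
        \<comment> \<open>The transform preserves the sum of the two sizes and, by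
          \<open>split\<close>, does not increase any representation count, so the induction
          hypothesis transfers directly.\<close>
        have "real t * min (real (card W) + real (card I) - real t - \<beta>) x \<le> trunc_sum W I t"
          using less.hyps[OF cI, of W t] I W True cIW cI less.prems by auto
        also have "trunc_sum W I t = trunc_sum I W t" using trunc_sum_commute I W by simp
        also have "trunc_sum I W t \<le> trunc_sum U V t"
          unfolding tr TU TI split by (intro sum_mono) auto
        finally show ?thesis using cIW by (simp add: add.commute flip: of_nat_add)
      next
        case tI: False
        \<comment> \<open>The intersection is now too small for level \<open>t\<close>, so the level
          is divided: \<open>i\<close> goes to the pair \<open>I\<close>, \<open>W\<close>, computed
          exactly, and \<open>t - i\<close> to the two remainders, treated by induction.\<close>
        define i where "i = card I"
        have cD: "card (U - I) = card U - i" "card (V' - I) = card V - i"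
          unfolding i_def using I V' fin cV' by (auto simp: card_Diff_subset)
        have i: "0 < i" "i < t" "i < card V" "t \<le> card U" "t \<le> card V" using I tI cI less.prems by (auto simp: i_def)
        have "real (t - i) * min (real (card (U - I)) + real (card (V' - I)) - real (t - i) - \<beta>) x
            \<le> trunc_sum (U - I) (V' - I) (t - i)"
          using i cD fin V' sub by (intro less.hyps) auto
        then have IH: "(real t - i) * min (real (card U) + real (card V) - i - t - \<beta>) x
            \<le> trunc_sum (U - I) (V' - I) (t - i)"
          using i cD by (simp add: of_nat_diff algebra_simps)
        \<comment> \<open>Truncation at \<open>i\<close> has no effect, since no element has more
          than \<open>card I\<close> representations; all pairs of \<open>I \<times> W\<close> are
          counted.\<close>
        have "trunc_sum I W i = (\<Sum>y\<in>X. rep I W y)"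
          unfolding TI using rep_le_card_left[OF I(2) W(2) I(1)] by (auto simp: i_def min_def intro!: sum.cong)
        also have "\<dots> = card (I \<times> W)"
          unfolding sum_rep[OF I(1) W(1) X]
          by (rule arg_cong[of _ _ card]) (use I in \<open>auto simp: X_def W_def intro!: set_mult_memI\<close>)
        finally have TIi: "trunc_sum I W i = i * card W" by (simp add: card_cartesian_product i_def)
        have "trunc_sum I W i + trunc_sum (U - I) (V' - I) (t - i) \<le> trunc_sum U V t"
          unfolding tr TU TI TD split sum.distrib[symmetric] using i by (intro sum_mono) auto
        then have "real i * card W + (real t - i) * min (real (card U) + real (card V) - i - t - \<beta>) x
            \<le> trunc_sum U V t"
          using IH unfolding TIi of_nat_le_iff[symmetric, where 'a = real] of_nat_add of_nat_mult
          by linarith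
        \<comment> \<open>If the minimum on the right is its first argument, expanding leaves a
          surplus of exactly \<open>i * \<beta>\<close>. Otherwise write \<open>t\<close> as i + (t
          - i) and bound the left minimum by \<open>c - i\<close> on the first part and by
          \<open>x\<close> on the second.\<close>
        moreover have "real t * min (real (card U) + real (card V) - real t - \<beta>) x
            \<le> real i * card W + (real t - i) * min (real (card U) + real (card V) - i - t - \<beta>) x"
        proof -
          define c where "c = real (card U) + real (card V)"
          have W: "real (card W) = c - i" using cIW unfolding c_def i_def by linarith
          have it: "0 \<le> real t - i" "0 \<le> real i" "i \<le> real t" using i by auto
          show ?thesis
          proof (cases "c - i - t - \<beta> \<le> x")
            case True
            have "real t * min (c - t - \<beta>) x \<le> real t * (c - t - \<beta>)" by (intro mult_left_mono) auto
            also have "\<dots> \<le> real i * (c - i) + (real t - i) * (c - i - t - \<beta>)"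
              using mult_nonneg_nonneg[OF it(2) \<open>\<beta> \<ge> 0\<close>] by (simp add: algebra_simps)
            finally show ?thesis using True W unfolding c_def by (simp add: min_absorb1)
          next
            case False
            have "real i * min (c - t - \<beta>) x \<le> real i * (c - i)"
              using it \<open>\<beta> \<ge> 0\<close> by (intro mult_left_mono) auto
            moreover have "(real t - i) * min (c - t - \<beta>) x \<le> (real t - i) * x"
              using it by (intro mult_left_mono) auto
            moreover have "real t * min (c - t - \<beta>) x
                = real i * min (c - t - \<beta>) x + (real t - i) * min (c - t - \<beta>) x"
              by (simp add: left_diff_distrib)
            moreover have x: "min (c - i - t - \<beta>) x = x" using False by simp
            ultimately show ?thesis unfolding c_def[symmetric] W x by linarith
          qed
        qed
        ultimately show ?thesis by linarith
      qed
    next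
      case False
      obtain v0 where v0: "v0 \<in> V" using \<open>V \<noteq> {}\<close> by blast
      \<comment> \<open>The translate of \<open>V\<close> that carries \<open>w\<close> to
        \<open>u\<close> meets \<open>U\<close>, hence lies in \<open>U\<close>.\<close>
      have shift: "u \<otimes> (v \<otimes> inv w) \<in> U" if "u \<in> U" "v \<in> V" "w \<in> V" for u v w
      proof -
        define e where "e = inv w \<otimes> u"
        have c: "u \<in> carrier G" "v \<in> carrier G" "w \<in> carrier G" using that sub by auto
        then have "e \<in> carrier G" "w \<otimes> e = u" unfolding e_def by (auto simp flip: m_assoc)
        then have "v \<otimes> e \<in> U" using False that by (metis disjoint_iff image_eqI image_subset_iff)
        moreover have "v \<otimes> e = u \<otimes> (v \<otimes> inv w)" unfolding e_def using c by (simp add: m_ac)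
        ultimately show ?thesis by simp
      qed
      define H where "H = {h \<in> carrier G. \<forall>u\<in>U. h \<otimes> u \<in> U}"
      have H: "subgroup H G" unfolding H_def using fin sub by (intro subgroup_stabilizer)
      obtain u0 where u0: "u0 \<in> U" using \<open>U \<noteq> {}\<close> by blast
      have injH: "inj_on (\<lambda>h. h \<otimes> u0) H" using u0 sub by (auto simp: inj_on_def H_def subset_iff)
      moreover have HU: "(\<lambda>h. h \<otimes> u0) ` H \<subseteq> U" using u0 unfolding H_def by auto
      ultimately have finH: "finite H" and cH: "card H \<le> card U"
        using fin by (auto intro: inj_on_finite card_inj_on_le)
      have "(\<lambda>v. v \<otimes> inv v0) ` V \<subseteq> H"
        unfolding H_def using shift v0 sub by (auto simp: subset_iff m_comm)
      moreover have "inj_on (\<lambda>v. v \<otimes> inv v0) V" using v0 sub by (auto simp: inj_on_def subset_iff)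
      ultimately have VH: "card V \<le> card H" using finH by (meson card_inj_on_le)
      have stab: "u \<otimes> v0 \<otimes> inv v \<in> U" if "u \<in> U" "v \<in> V" for u v
        using shift[OF that(1) v0 that(2)] that v0 sub by (simp add: m_assoc subset_iff)
      have "t * card U \<le> trunc_sum U V t"
        by (rule trunc_sum_stable[OF fin sub v0]) (use stab less.prems in auto)
      then have "real t * real (card U) \<le> trunc_sum U V t" by (metis of_nat_le_iff of_nat_mult)
      \<comment> \<open>If the stabiliser has size at most \<open>x\<close>, then
        \<open>card V \<le> card H \<le> \<beta>\<close> and the first argument is at most
        \<open>card U\<close>; otherwise \<open>x < card H \<le> card U\<close>.\<close>
      moreover have "min (real (card U) + real (card V) - real t - \<beta>) x \<le> card U"
        using \<beta>[OF H finH] cH VH by linarith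
      ultimately show ?thesis by (meson mult_left_mono of_nat_0_le_iff order_trans)
    qed
  qed simp
qed

text \<open>The truncated sum is at least \<open>t * x\<close>. Truncation limits each element of
  \<open>P\<close> to a contribution of \<open>t\<close>, so the rest must come from pairs with
  product outside \<open>P\<close>.\<close>

lemma card_pairs_outside_ge:
  fixes x \<beta> :: real
  assumes "finite U" and "finite V" and "U \<subseteq> carrier G" and "V \<subseteq> carrier G" and "finite P"
    and "t \<le> card U" and "t \<le> card V" and "\<beta> \<ge> 0"
    and \<beta>: "\<And>H. subgroup H G \<Longrightarrow> finite H \<Longrightarrow> real (card H) \<le> x \<Longrightarrow> real (card H) \<le> \<beta>"
    and "x \<le> real (card U) + real (card V) - real t - \<beta>"
  shows "real t * (x - real (card P)) \<le> card {(u, v). u \<in> U \<and> v \<in> V \<and> u \<otimes> v \<notin> P}"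
proof -
  let ?S = "U <#> V"
  have finS: "finite ?S" using assms finite_set_mult by simp
  have "real t * x \<le> trunc_sum U V t"
    using pollard_kneser[OF assms(1-4) assms(6-8) \<beta>, of x] assms(10) by (simp add: min_absorb2)
  moreover have "trunc_sum U V t \<le> (\<Sum>y\<in>?S \<inter> P. t) + (\<Sum>y\<in>?S - P. rep U V y)"
    unfolding trunc_sum_def using finS
    by (subst sum.Int_Diff[OF finS, of _ P], intro add_mono sum_mono) auto
  moreover have "(\<Sum>y\<in>?S - P. rep U V y) = card {(u, v). u \<in> U \<and> v \<in> V \<and> u \<otimes> v \<notin> P}"
    using finS set_mult_memI by (subst sum_rep[OF assms(1,2)]) (auto intro!: arg_cong[of _ _ card])
  moreover have "(\<Sum>y\<in>?S \<inter> P. t) \<le> t * card P"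
    using card_mono[of P "?S \<inter> P"] \<open>finite P\<close> by simp
  ultimately have "real t * x \<le> real (t * card P + card {(u, v). u \<in> U \<and> v \<in> V \<and> u \<otimes> v \<notin> P})"
    by linarith
  then show ?thesis by (simp add: algebra_simps)
qed

end

section \<open>Refining containers\<close>

lemma card_pairs_fst:
  assumes "finite U" and "finite V"
  shows "card {(u, v). u \<in> U \<and> v \<in> V \<and> R u v} = (\<Sum>u\<in>U. card {v \<in> V. R u v})"
proof -
  have "{(u, v). u \<in> U \<and> v \<in> V \<and> R u v} = (SIGMA u:U. {v \<in> V. R u v})" by auto
  then show ?thesis using assms by simp
qed

lemma card_pairs_snd:
  assumes "finite U" and "finite V"
  shows "card {(u, v). u \<in> U \<and> v \<in> V \<and> R u v} = (\<Sum>v\<in>V. card {u \<in> U. R u v})"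
proof -
  have "card {(u, v). u \<in> U \<and> v \<in> V \<and> R u v} = card {(v, u). v \<in> V \<and> u \<in> U \<and> R u v}"
    by (rule bij_betw_same_card[of prod.swap], rule bij_betwI[of _ _ _ prod.swap]) auto
  then show ?thesis using card_pairs_fst[OF assms(2,1), of "\<lambda>v u. R u v"] by simp
qed

text \<open>A popularity argument: terms below the threshold contribute at most
  \<open>\<theta>\<close> each, so a large sum forces many heavy terms.\<close>

lemma sum_le_heavy:
  fixes f :: "'c \<Rightarrow> real"
  assumes "finite U" and "\<And>u. u \<in> U \<Longrightarrow> f u \<le> a" and "\<theta> \<ge> 0"
  shows "(\<Sum>u\<in>U. f u) \<le> a * card {u \<in> U. \<theta> \<le> f u} + \<theta> * card U"
proof -
  have "(\<Sum>u\<in>U. f u) = (\<Sum>u\<in>{u \<in> U. \<theta> \<le> f u}. f u) + (\<Sum>u\<in>{u \<in> U. \<not> \<theta> \<le> f u}. f u)"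
    using assms(1) by (subst sum.union_disjoint[symmetric]) (auto intro!: sum.cong)
  also have "\<dots> \<le> card {u \<in> U. \<theta> \<le> f u} * a + card {u \<in> U. \<not> \<theta> \<le> f u} * \<theta>"
    using assms by (intro add_mono sum_bounded_above) auto
  also have "\<dots> \<le> a * card {u \<in> U. \<theta> \<le> f u} + \<theta> * card U"
  proof -
    have "real (card {u \<in> U. \<not> \<theta> \<le> f u}) * \<theta> \<le> real (card U) * \<theta>"
      using assms by (intro mult_right_mono) (auto intro: card_mono)
    then show ?thesis by (simp add: mult.commute)
  qed
  finally show ?thesis .
qed

context comm_group
begin

lemma card_translate_diff:
  assumes "F \<subseteq> carrier G" and "y \<in> carrier G"
  shows "card ((\<lambda>f. f \<otimes> y) ` F - P) = card {f \<in> F. f \<otimes> y \<notin> P}"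
proof -
  have "(\<lambda>f. f \<otimes> y) ` F - P = (\<lambda>f. f \<otimes> y) ` {f \<in> F. f \<otimes> y \<notin> P}" by auto
  moreover have "inj_on (\<lambda>f. f \<otimes> y) {f \<in> F. f \<otimes> y \<notin> P}"
    using assms by (auto simp: inj_on_def subset_iff)
  ultimately show ?thesis by (simp add: card_image)
qed

text \<open>For fixed \<open>f\<close>, multiplication by \<open>f\<close> is injective, so at most
  \<open>card P\<close> choices of \<open>v\<close> land in \<open>P\<close>.\<close>

lemma card_pairs_into_le:
  assumes "F \<subseteq> carrier G" and "V \<subseteq> carrier G" and "finite F" and "finite V" and "finite P"
  shows "card {(f, v). f \<in> F \<and> v \<in> V \<and> f \<otimes> v \<in> P} \<le> card F * card P"
proof -
  have "card {v \<in> V. f \<otimes> v \<in> P} \<le> card P" if "f \<in> F" for f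
    by (rule card_inj_on_le[of "\<lambda>v. f \<otimes> v"]) (use assms that in \<open>auto simp: inj_on_def subset_iff\<close>)
  then have "(\<Sum>f\<in>F. card {v \<in> V. f \<otimes> v \<in> P}) \<le> card F * card P"
    using sum_bounded_above[of F _ "card P"] by simp
  then show ?thesis by (simp add: card_pairs_fst[OF assms(3,4)])
qed

definition sumset_pairs :: "'a set \<Rightarrow> 'a set \<Rightarrow> 'a set \<Rightarrow> nat \<Rightarrow> ('a set \<times> 'a set) set" where
  "sumset_pairs U V P m =
     {(A, B). A \<subseteq> U \<and> B \<subseteq> V \<and> P \<subseteq> A <#> B \<and> card (A <#> B) \<le> m}"

lemma sumset_pairs_subset: "sumset_pairs U V P m \<subseteq> Pow U \<times> Pow V"
  unfolding sumset_pairs_def by auto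

lemma card_sumset_pairs_trivial:
  assumes "finite U" and "finite V"
  shows "card (sumset_pairs U V P m) \<le> 2 ^ (card U + card V)"
proof -
  have "card (sumset_pairs U V P m) \<le> card (Pow U \<times> Pow V)"
    using assms by (intro card_mono sumset_pairs_subset) auto
  then show ?thesis using assms by (simp add: card_cartesian_product card_Pow power_add)
qed

text \<open>If the containers \<open>U, V\<close> are too large, many pairs of \<open>U \<times> V\<close> have their product outside
  the known part \<open>P\<close> of the sumset. Recording few elements of \<open>A\<close> or \<open>B\<close> then either shrinks
  a container or enlarges \<open>P\<close>; the potential is \<open>|U| + |V| + m - |P|\<close>, and each recorded
  element costs a factor \<open>n\<close>.\<close>

lemma card_sumset_pairs_le:
  fixes M d T :: real and K m n :: nat
  assumes Y: "finite Y" "Y \<subseteq> carrier G" "card Y = n" and "n \<ge> 12"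
    and "M > 0" and "d > 0" and "K > 0" and Kd: "2 * real K \<le> d"
    and many: "\<And>U V P. U \<subseteq> Y \<Longrightarrow> V \<subseteq> Y \<Longrightarrow> finite P \<Longrightarrow> card P \<le> m \<Longrightarrow> card U \<le> M \<Longrightarrow> card V \<le> M
      \<Longrightarrow> T < real (card U) + real (card V)
      \<Longrightarrow> 2 * M * d \<le> card {(u, v). u \<in> U \<and> v \<in> V \<and> u \<otimes> v \<notin> P}"
    and "U \<subseteq> Y" and "V \<subseteq> Y" and "finite P" and "card P \<le> m" and "card U \<le> M" and "card V \<le> M"
  shows "card (sumset_pairs U V P m) \<le>
    real n powr (2 * (real K + 1) / d * (real (card U) + real (card V) + (real m - real (card P)))
      + 2 * M / (K * d) * (real m - real (card P))) * 2 powr T"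
  using assms(10-15)
proof (induction "card U + card V + (m - card P)" arbitrary: U V P rule: less_induct)
  case less
  \<comment> \<open>A drop of \<open>d / 2\<close> in the potential pays for \<open>K\<close>
    recorded elements and one spare factor \<open>n\<close>; growth of the known part by
    \<open>\<delta>\<close> pays for one more recorded element.\<close>
  define c where "c = 2 * (real K + 1) / d"
  define \<delta> where "\<delta> = K * d / (2 * M)"
  define E where "E U V P = c * (real (card U) + real (card V) + (real m - real (card P)))
      + (real m - real (card P)) / \<delta>" for U V P :: "'a set"
  have c: "c > 0" "c * (d / 2) = real K + 1" unfolding c_def using \<open>d > 0\<close> by (auto simp: field_simps)
  have \<delta>: "\<delta> > 0" unfolding \<delta>_def using \<open>d > 0\<close> \<open>M > 0\<close> \<open>K > 0\<close> by simp
  have E: "2 * (real K + 1) / d * (real (card U) + real (card V) + (real m - real (card P)))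
      + 2 * M / (K * d) * (real m - real (card P)) = E U V P" for U V P :: "'a set"
    unfolding E_def c_def \<delta>_def by simp
  have fin: "finite U" "finite V" and sub: "U \<subseteq> carrier G" "V \<subseteq> carrier G"
    using less.prems Y by (auto intro: finite_subset)
  have IH: "card (sumset_pairs U' V' P' m) \<le> real n powr (E U' V' P') * 2 powr T"
    if "card U' + card V' + (m - card P') < card U + card V + (m - card P)"
      "U' \<subseteq> U" "V' \<subseteq> V" "finite P'" "card P' \<le> m" for U' V' P'
  proof -
    have "card U' \<le> card U" "card V' \<le> card V" using that fin by (auto intro: card_mono)
    then show ?thesis using less.hyps[of U' V' P'] that less.prems unfolding E by auto
  qed
  show ?case unfolding E
  proof (cases "real (card U) + real (card V) \<le> T")
    case True
    have "real (card (sumset_pairs U V P m)) \<le> 2 ^ (card U + card V)"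
      using card_sumset_pairs_trivial[OF fin, of P m] by (metis of_nat_le_iff of_nat_numeral of_nat_power)
    also have "\<dots> = 2 powr (real (card U) + real (card V))" by (simp flip: powr_realpow)
    also have "\<dots> \<le> 2 powr T" using True by simp
    also have "\<dots> \<le> real n powr (E U V P) * 2 powr T"
    proof -
      have "E U V P \<ge> 0" unfolding E_def using c \<delta> less.prems by (intro add_nonneg_nonneg) auto
      then have "real n powr (E U V P) \<ge> 1" using \<open>n \<ge> 12\<close> by (intro ge_one_powr_ge_zero) auto
      then show ?thesis by simp
    qed
    finally show "card (sumset_pairs U V P m) \<le> real n powr (E U V P) * 2 powr T" .
  next
    case False
    \<comment> \<open>The popular elements of \<open>U\<close>. The unpopular ones account for at
      most half of the \<open>2 * M * d\<close> pairs, so there are at least \<open>d\<close>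
      popular ones.\<close>
    define Uh where "Uh = {u \<in> U. d \<le> card {v \<in> V. u \<otimes> v \<notin> P}}"
    have "2 * M * d \<le> (\<Sum>u\<in>U. real (card {v \<in> V. u \<otimes> v \<notin> P}))"
      using many[of U V P] less.prems False card_pairs_fst[OF fin, of "\<lambda>u v. u \<otimes> v \<notin> P"] by simp
    also have "\<dots> \<le> M * card Uh + d * card U"
    proof -
      have "real (card {v \<in> V. u \<otimes> v \<notin> P}) \<le> M" for u
        using card_mono[of V "{v \<in> V. u \<otimes> v \<notin> P}"] fin less.prems by fastforce
      then show ?thesis unfolding Uh_def using \<open>d > 0\<close> fin by (intro sum_le_heavy) auto
    qed
    also have "\<dots> \<le> M * card Uh + d * M" using less.prems \<open>d > 0\<close> by simp
    finally have "M * d \<le> M * card Uh" by (simp add: algebra_simps)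
    then have Uh: "d \<le> card Uh" using \<open>M > 0\<close> by simp
    have UhU: "Uh \<subseteq> U" "finite Uh" unfolding Uh_def using fin by auto
    \<comment> \<open>Two branches. If \<open>A\<close> has at most \<open>K\<close> popular
      elements, recording them as \<open>S\<close> replaces \<open>U\<close> by \<open>US S\<close>,
      smaller by at least \<open>d / 2\<close>. Otherwise record \<open>K\<close> of them as
      \<open>F1\<close> and a greedy set \<open>F2\<close> from \<open>B\<close>; the known part
      grows to \<open>PP F1 F2\<close>, and \<open>B\<close> lies in
      \<open>VV F1 F2\<close>.\<close>
    define US where "US S = S \<union> (U - Uh)" for S
    define PP where "PP F1 F2 = P \<union> (\<Union>b\<in>F2. (\<lambda>f. f \<otimes> b) ` F1)" for F1 F2
    define VV where "VV F1 F2 = {v \<in> V. card {f \<in> F1. f \<otimes> v \<notin> PP F1 F2} < \<delta>}" for F1 F2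
    define \<S> where "\<S> = {S. S \<subseteq> Uh \<and> card S \<le> K}"
    define \<T> where "\<T> = {(F1, F2). F1 \<subseteq> Uh \<and> card F1 = K \<and> F2 \<subseteq> V \<and> card (PP F1 F2) \<le> m
      \<and> \<delta> * card F2 \<le> real (card (PP F1 F2)) - real (card P)}"
    have Ssub: "\<S> \<subseteq> Pow Y" and Tsub: "\<T> \<subseteq> Pow Y \<times> Pow Y"
      unfolding \<S>_def \<T>_def using UhU less.prems by auto
    have finST: "finite \<S>" "finite \<T>" using Ssub Tsub Y by (auto intro: finite_subset)
    have cover: "sumset_pairs U V P m \<subseteq> (\<Union>S\<in>\<S>. sumset_pairs (US S) V P m)
        \<union> (\<Union>(F1, F2)\<in>\<T>. sumset_pairs U (VV F1 F2) (PP F1 F2) m)"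
    proof clarify
      fix A B assume AB: "(A, B) \<in> sumset_pairs U V P m"
        and notT: "(A, B) \<notin> (\<Union>(F1, F2)\<in>\<T>. sumset_pairs U (VV F1 F2) (PP F1 F2) m)"
      have AB': "A \<subseteq> U" "B \<subseteq> V" "P \<subseteq> A <#> B" "card (A <#> B) \<le> m" "finite A" "finite B"
        using AB fin unfolding sumset_pairs_def by (auto intro: finite_subset)
      have "card (A \<inter> Uh) \<le> K"
      proof (rule ccontr)
        assume "\<not> ?thesis"
        then obtain F1 where F1: "F1 \<subseteq> A \<inter> Uh" "card F1 = K"
          by (metis linorder_not_le nat_less_le obtain_subset_with_card_n)
        then have F1': "finite F1" "F1 \<subseteq> carrier G" using AB' sub by (auto intro: finite_subset)
        obtain F2 where F2: "F2 \<subseteq> B"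
          "\<delta> * card F2 \<le> real (card (PP F1 F2)) - real (card P)"
          "\<And>b. b \<in> B \<Longrightarrow> real (card ((\<lambda>f. f \<otimes> b) ` F1 - PP F1 F2)) < \<delta>"
          using greedy_cover[of B "\<lambda>b. (\<lambda>f. f \<otimes> b) ` F1" P \<delta>] AB' F1' \<delta> less.prems unfolding PP_def by blast
        have PPs: "PP F1 F2 \<subseteq> A <#> B"
          unfolding PP_def using AB'(3) F1 F2(1) by (auto intro!: set_mult_memI)
        then have "card (PP F1 F2) \<le> m" 
          using card_mono[OF finite_set_mult[OF AB'(5,6)] PPs] AB'(4) by linarith
        then have "(F1, F2) \<in> \<T>" unfolding \<T>_def using F1 F2 AB' by auto
        moreover have "B \<subseteq> VV F1 F2"
          unfolding VV_def using F2(3) AB' sub F1' by (auto simp: card_translate_diff subset_iff)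
        then have "(A, B) \<in> sumset_pairs U (VV F1 F2) (PP F1 F2) m"
          unfolding sumset_pairs_def using AB' PPs by auto
        ultimately show False using notT by blast
      qed
      then have "A \<inter> Uh \<in> \<S>" unfolding \<S>_def by auto
      moreover have "(A, B) \<in> sumset_pairs (US (A \<inter> Uh)) V P m"
        unfolding sumset_pairs_def US_def using AB' by auto
      ultimately show "(A, B) \<in> (\<Union>S\<in>\<S>. sumset_pairs (US S) V P m)" by blast
    qed
    \<comment> \<open>The spare factor \<open>n\<close> absorbs the weighted sums over
      \<open>S\<close> and over \<open>F1\<close>, \<open>F2\<close>, which are at most 3 and 3 * 3;
      this is why \<open>n \<ge> 12\<close> is assumed.\<close>
    define Q where "Q = real n powr (E U V P - 1) * 2 powr T"
    have n: "real n > 0" "real n \<ge> 1" using \<open>n \<ge> 12\<close> by auto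
    have boundS: "real (card (sumset_pairs (US S) V P m)) \<le> Q * real n powr (- real (card S))"
      if S: "S \<in> \<S>" for S
    proof -
      have S': "S \<subseteq> Uh" "card S \<le> K" using S unfolding \<S>_def by auto
      have "card (US S) \<le> card S + card (U - Uh)" unfolding US_def by (rule card_Un_le)
      moreover have "card (U - Uh) = card U - card Uh" using UhU by (simp add: card_Diff_subset)
      moreover have "card Uh \<le> card U" using UhU fin by (simp add: card_mono)
      ultimately have cUS: "real (card (US S)) \<le> real (card U) - d / 2" using S' Uh Kd by linarith
      have "card (sumset_pairs (US S) V P m) \<le> real n powr (E (US S) V P) * 2 powr T"
        using cUS \<open>d > 0\<close> less.prems S' UhU by (intro IH) (auto simp: US_def)
      also have "\<dots> \<le> real n powr (E U V P - 1 - real (card S)) * 2 powr T"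
      proof -
        have "c * real (card (US S)) \<le> c * (real (card U) - d / 2)" using cUS c by simp
        then have "c * real (card (US S)) \<le> c * real (card U) - (real K + 1)"
          using c unfolding right_diff_distrib by linarith
        then have "E (US S) V P \<le> E U V P - 1 - real (card S)"
          unfolding E_def using S' by (simp add: algebra_simps)
        then show ?thesis using n by (simp add: powr_mono)
      qed
      also have "\<dots> = Q * real n powr (- real (card S))"
        unfolding Q_def using n by (simp add: powr_diff powr_minus divide_inverse)
      finally show ?thesis .
    qed
    have boundT: "real (card (sumset_pairs U (VV F1 F2) (PP F1 F2) m))
        \<le> Q * (real n powr (- real (card F1)) * real n powr (- real (card F2)))"
      if F: "(F1, F2) \<in> \<T>" for F1 F2
    proof -
      have F': "F1 \<subseteq> Uh" "card F1 = K" "F2 \<subseteq> V" "card (PP F1 F2) \<le> m"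
        "\<delta> * card F2 \<le> real (card (PP F1 F2)) - real (card P)" using F unfolding \<T>_def by auto
      have F1: "finite F1" "F1 \<subseteq> U" "F1 \<subseteq> carrier G" and F2: "finite F2"
        using F' UhU fin sub by (auto intro: finite_subset)
      have PP: "finite (PP F1 F2)" "P \<subseteq> PP F1 F2" unfolding PP_def using less.prems F1 F2 by auto
      define gr where "gr = real (card (PP F1 F2)) - real (card P)"
      define rm where "rm = real (card V) - real (card (VV F1 F2))"
      have gr: "real (card (PP F1 F2 - P)) = gr"
        unfolding gr_def using PP by (simp add: card_Diff_subset card_mono finite_subset of_nat_diff)
      have VVV: "VV F1 F2 \<subseteq> V" unfolding VV_def by auto
      have "V - VV F1 F2 = {v \<in> V. \<delta> \<le> card {f \<in> F1. f \<otimes> v \<notin> PP F1 F2}}" unfolding VV_def by auto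
      then have rm: "real (card {v \<in> V. \<delta> \<le> card {f \<in> F1. f \<otimes> v \<notin> PP F1 F2}}) = rm"
        unfolding rm_def using VVV fin
        by (metis card_Diff_subset card_mono finite_subset of_nat_diff)
      \<comment> \<open>Count the pairs of \<open>F1 \<times> V\<close> with product outside
        \<open>P\<close>. Products in the new part give at most \<open>K * gr\<close>, removed
        elements of \<open>V\<close> at most \<open>K * rm\<close>, and the remaining ones at most
        \<open>\<delta> * M\<close>, which is half of \<open>K * d\<close>. Hence
        \<open>rm + gr\<close> is at least \<open>d / 2\<close>.\<close>
      have "K * d \<le> (\<Sum>f\<in>F1. real (card {v \<in> V. f \<otimes> v \<notin> P}))"
        using sum_bounded_below[of F1 d "\<lambda>f. real (card {v \<in> V. f \<otimes> v \<notin> P})"] F' unfolding Uh_def by auto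
      also have "\<dots> \<le> (\<Sum>f\<in>F1. real (card {v \<in> V. f \<otimes> v \<notin> PP F1 F2})
          + real (card {v \<in> V. f \<otimes> v \<in> PP F1 F2 - P}))"
      proof (intro sum_mono)
        fix f
        have "card {v \<in> V. f \<otimes> v \<notin> P}
            \<le> card ({v \<in> V. f \<otimes> v \<notin> PP F1 F2} \<union> {v \<in> V. f \<otimes> v \<in> PP F1 F2 - P})"
          using fin by (intro card_mono) auto
        also have "\<dots> \<le> card {v \<in> V. f \<otimes> v \<notin> PP F1 F2} + card {v \<in> V. f \<otimes> v \<in> PP F1 F2 - P}"
          by (rule card_Un_le)
        finally show "real (card {v \<in> V. f \<otimes> v \<notin> P}) \<le> real (card {v \<in> V. f \<otimes> v \<notin> PP F1 F2})
          + real (card {v \<in> V. f \<otimes> v \<in> PP F1 F2 - P})" by linarith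
      qed
      also have "\<dots> = (\<Sum>v\<in>V. real (card {f \<in> F1. f \<otimes> v \<notin> PP F1 F2}))
          + real (card {(f, v). f \<in> F1 \<and> v \<in> V \<and> f \<otimes> v \<in> PP F1 F2 - P})"
        using card_pairs_fst[OF F1(1) fin(2), of "\<lambda>f v. f \<otimes> v \<in> PP F1 F2 - P"]
          card_pairs_fst[OF F1(1) fin(2), of "\<lambda>f v. f \<otimes> v \<notin> PP F1 F2"]
          card_pairs_snd[OF F1(1) fin(2), of "\<lambda>f v. f \<otimes> v \<notin> PP F1 F2"]
        by (simp add: sum.distrib flip: of_nat_sum)
      also have "\<dots> \<le> (K * rm + \<delta> * card V) + K * gr"
      proof (intro add_mono)
        have "real (card {f \<in> F1. f \<otimes> v \<notin> PP F1 F2}) \<le> K" for v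
          using card_mono[OF F1(1), of "{f \<in> F1. f \<otimes> v \<notin> PP F1 F2}"] F' by auto
        then show "(\<Sum>v\<in>V. real (card {f \<in> F1. f \<otimes> v \<notin> PP F1 F2})) \<le> K * rm + \<delta> * card V"
          unfolding rm[symmetric] using \<delta> fin by (intro sum_le_heavy) auto
        have "card {(f, v). f \<in> F1 \<and> v \<in> V \<and> f \<otimes> v \<in> PP F1 F2 - P} \<le> K * card (PP F1 F2 - P)"
          using card_pairs_into_le[OF F1(3) sub(2) F1(1) fin(2), of "PP F1 F2 - P"] PP F' by simp
        then show "real (card {(f, v). f \<in> F1 \<and> v \<in> V \<and> f \<otimes> v \<in> PP F1 F2 - P}) \<le> K * gr"
          unfolding gr[symmetric] of_nat_mult[symmetric] of_nat_le_iff .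
      qed
      also have "\<dots> \<le> (K * rm + \<delta> * M) + K * gr" using less.prems \<delta> by simp
      also have "\<dots> = K * (rm + d / 2 + gr)" unfolding \<delta>_def using \<open>M > 0\<close> by (simp add: field_simps)
      finally have drop: "d / 2 \<le> rm + gr" using \<open>K > 0\<close> by simp
      have "card (sumset_pairs U (VV F1 F2) (PP F1 F2) m) \<le> real n powr (E U (VV F1 F2) (PP F1 F2)) * 2 powr T"
      proof (rule IH)
        show "card U + card (VV F1 F2) + (m - card (PP F1 F2)) < card U + card V + (m - card P)"
          using drop \<open>d > 0\<close> F' less.prems unfolding rm_def gr_def by linarith
      qed (use VVV PP F' in auto)
      also have "\<dots> \<le> real n powr (E U V P - 1 - real (card F1) - real (card F2)) * 2 powr T"
      proof -
        have "c * (d / 2) \<le> c * (rm + gr)" using drop c by (intro mult_left_mono) auto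
        then have "real K + 1 \<le> c * (rm + gr)" unfolding c(2) .
        moreover have "card F2 \<le> gr / \<delta>" using F' \<delta> unfolding gr_def by (simp add: field_simps)
        moreover have "E U (VV F1 F2) (PP F1 F2) = E U V P - c * (rm + gr) - gr / \<delta>"
          unfolding E_def rm_def gr_def by (simp add: algebra_simps diff_divide_distrib add_divide_distrib)
        ultimately have "E U (VV F1 F2) (PP F1 F2) \<le> E U V P - 1 - real (card F1) - real (card F2)"
          using F' by linarith
        then show ?thesis using n by (simp add: powr_mono)
      qed
      also have "\<dots> = Q * (real n powr (- real (card F1)) * real n powr (- real (card F2)))"
        unfolding Q_def using n by (simp add: powr_diff powr_minus divide_inverse)
      finally show ?thesis .
    qed
    have Q0: "Q \<ge> 0" unfolding Q_def by simp
    have Y3: "(\<Sum>F\<in>Pow Y. real n powr (- real (card F))) \<le> 3"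
      using sum_Pow_powr_card_le[OF Y(1), of n] n Y exp_le by simp
    have Y0: "0 \<le> (\<Sum>F\<in>Pow Y. real n powr (- real (card F)))" by (intro sum_nonneg) auto
    have "card (sumset_pairs U V P m) \<le> card ((\<Union>S\<in>\<S>. sumset_pairs (US S) V P m)
        \<union> (\<Union>(F1, F2)\<in>\<T>. sumset_pairs U (VV F1 F2) (PP F1 F2) m))"
    proof (rule card_mono[OF _ cover])
      have "finite (sumset_pairs U' V' P' m)" if "U' \<subseteq> U" "V' \<subseteq> V" for U' V' P'
        by (rule finite_subset[OF sumset_pairs_subset]) (use that fin in \<open>auto intro: finite_subset\<close>)
      moreover have "US S \<subseteq> U" if "S \<in> \<S>" for S using that UhU unfolding US_def \<S>_def by auto
      moreover have "VV F1 F2 \<subseteq> V" for F1 F2 unfolding VV_def by auto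
      ultimately show "finite ((\<Union>S\<in>\<S>. sumset_pairs (US S) V P m)
        \<union> (\<Union>(F1, F2)\<in>\<T>. sumset_pairs U (VV F1 F2) (PP F1 F2) m))" using finST by auto
    qed
    also have "\<dots> \<le> (\<Sum>S\<in>\<S>. card (sumset_pairs (US S) V P m))
        + (\<Sum>x\<in>\<T>. card (case x of (F1, F2) \<Rightarrow> sumset_pairs U (VV F1 F2) (PP F1 F2) m))"
      by (intro order_trans[OF card_Un_le] add_mono card_UN_le finST)
    finally have "real (card (sumset_pairs U V P m)) \<le> (\<Sum>S\<in>\<S>. real (card (sumset_pairs (US S) V P m)))
        + (\<Sum>x\<in>\<T>. real (card (case x of (F1, F2) \<Rightarrow> sumset_pairs U (VV F1 F2) (PP F1 F2) m)))"
      by (simp flip: of_nat_sum of_nat_add)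
    also have "\<dots> \<le> (\<Sum>S\<in>\<S>. Q * real n powr (- real (card S)))
        + (\<Sum>(F1, F2)\<in>\<T>. Q * (real n powr (- real (card F1)) * real n powr (- real (card F2))))"
      by (intro add_mono sum_mono) (auto simp: boundS boundT split: prod.splits)
    also have "\<dots> \<le> (\<Sum>S\<in>Pow Y. Q * real n powr (- real (card S)))
        + (\<Sum>(F1, F2)\<in>Pow Y \<times> Pow Y. Q * (real n powr (- real (card F1)) * real n powr (- real (card F2))))"
      using Y Q0 Ssub Tsub by (intro add_mono sum_mono2) auto
    also have "\<dots> = Q * (\<Sum>F\<in>Pow Y. real n powr (- real (card F)))
        + Q * ((\<Sum>F\<in>Pow Y. real n powr (- real (card F))) * (\<Sum>F\<in>Pow Y. real n powr (- real (card F))))"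
    proof -
      have "(\<Sum>(F1, F2)\<in>Pow Y \<times> Pow Y. real n powr (- real (card F1)) * real n powr (- real (card F2)))
        = (\<Sum>F\<in>Pow Y. real n powr (- real (card F))) * (\<Sum>F\<in>Pow Y. real n powr (- real (card F)))"
        by (simp add: sum_product sum.cartesian_product)
      then show ?thesis by (simp add: sum_distrib_left[symmetric] case_prod_unfold)
    qed
    also have "\<dots> \<le> Q * 3 + Q * (3 * 3)"
      using Y0 Y3 Q0 by (intro add_mono mult_left_mono mult_mono) auto
    also have "\<dots> \<le> Q * n" using Q0 \<open>n \<ge> 12\<close> mult_left_mono[of 12 "real n" Q] by simp
    also have "\<dots> = real n powr (E U V P) * 2 powr T"
      unfolding Q_def using n by (simp add: powr_diff)
    finally show "card (sumset_pairs U V P m) \<le> real n powr (E U V P) * 2 powr T" .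
  qed
qed

end

section \<open>Containers for pairs of large sets\<close>

lemma card_subsets_of_card_le_power:
  assumes "finite Y"
  shows "card {F. F \<subseteq> Y \<and> card F = k} \<le> card Y ^ k"
  using n_subsets[OF assms, of k] binomial_le_pow[of k "card Y"] binomial_eq_0[of "card Y" k]
  by (cases "k \<le> card Y") auto

text \<open>Rankin's trick: every counted set has weight \<open>real n powr (q - card Z)\<close> at
  least 1, and the weights are then summed over all subsets.\<close>

lemma card_subsets_of_card_le_powr:
  fixes q :: real
  assumes "finite J" and "n > 0"
  shows "card {Z. Z \<subseteq> J \<and> card Z \<le> q} \<le> exp (card J / n) * real n powr q"
proof -
  have "real (card {Z. Z \<subseteq> J \<and> card Z \<le> q}) = (\<Sum>Z\<in>{Z. Z \<subseteq> J \<and> card Z \<le> q}. 1)" by simp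
  also have "\<dots> \<le> (\<Sum>Z\<in>{Z. Z \<subseteq> J \<and> card Z \<le> q}. real n powr (q - card Z))"
    using assms by (intro sum_mono ge_one_powr_ge_zero) auto
  also have "\<dots> \<le> (\<Sum>Z\<in>Pow J. real n powr (q - card Z))"
    using assms by (intro sum_mono2) auto
  also have "\<dots> = real n powr q * (\<Sum>Z\<in>Pow J. real n powr (- real (card Z)))"
    using assms by (simp add: sum_distrib_left powr_diff powr_minus divide_inverse)
  also have "\<dots> \<le> real n powr q * exp (card J / n)"
    using assms by (intro mult_left_mono sum_Pow_powr_card_le) auto
  finally show ?thesis by (simp add: mult.commute)
qed

context comm_group
begin

text \<open>Each \<open>y\<close> in the container sends more than \<open>card F - \<delta>\<close>
  elements of \<open>F\<close> into \<open>Q\<close>, while at most \<open>card F * card Q\<close>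
  pairs have their product in \<open>Q\<close>.\<close>

lemma card_container_le:
  fixes \<delta> :: real
  assumes "finite Y" and "Y \<subseteq> carrier G" and "finite F" and "F \<subseteq> carrier G" and "finite Q"
  shows "(card F - \<delta>) * card {y \<in> Y. card {f \<in> F. f \<otimes> y \<notin> Q} < \<delta>} \<le> card F * card Q"
proof -
  define U where "U = {y \<in> Y. card {f \<in> F. f \<otimes> y \<notin> Q} < \<delta>}"
  have U: "finite U" "U \<subseteq> carrier G" unfolding U_def using assms by auto
  have "card F - \<delta> \<le> card {f \<in> F. f \<otimes> y \<in> Q}" if "y \<in> U" for y
  proof -
    have "F = {f \<in> F. f \<otimes> y \<notin> Q} \<union> {f \<in> F. f \<otimes> y \<in> Q}" by auto
    then have "card F \<le> card {f \<in> F. f \<otimes> y \<notin> Q} + card {f \<in> F. f \<otimes> y \<in> Q}" by (metis card_Un_le)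
    then show ?thesis using that unfolding U_def by simp
  qed
  then have "(card F - \<delta>) * card U \<le> (\<Sum>y\<in>U. real (card {f \<in> F. f \<otimes> y \<in> Q}))"
    using sum_bounded_below[of U "card F - \<delta>"] by (simp add: mult.commute)
  also have "\<dots> = card {(f, y). f \<in> F \<and> y \<in> U \<and> f \<otimes> y \<in> Q}"
    by (simp add: card_pairs_snd[OF assms(3) U(1)])
  also have "\<dots> \<le> card F * card Q"
    using card_pairs_into_le[OF assms(4) U(2) assms(3) U(1) assms(5)] by (simp flip: of_nat_mult)
  finally show ?thesis unfolding U_def by simp
qed

lemma card_le_card_set_mult:
  assumes "A \<subseteq> carrier G" and "B \<subseteq> carrier G" and "finite A" and "finite B" and "B \<noteq> {}"
  shows "card A \<le> card (A <#> B)"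
proof -
  obtain b where b: "b \<in> B" using assms(5) by blast
  show ?thesis
    by (rule card_inj_on_le[of "\<lambda>a. a \<otimes> b"])
      (use b assms finite_set_mult in \<open>auto simp: inj_on_def subset_iff intro!: set_mult_memI\<close>)
qed

text \<open>The first container step. Two \<open>k\<close>-subsets and a set \<open>Z\<close> of
  translates determine containers for \<open>A\<close> and \<open>B\<close>; \<open>b\<close> bounds
  the number of pairs left inside them.\<close>

lemma card_large_sumset_pairs_le:
  fixes \<delta> b :: real and k m n :: nat
  assumes Y: "finite Y" "Y \<subseteq> carrier G" "card Y = n" and "n > 0" and "k > 0" and "\<delta> > 0"
    and bound: "\<And>U V. U \<subseteq> Y \<Longrightarrow> V \<subseteq> Y \<Longrightarrow> (k - \<delta>) * card U \<le> real k * m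
      \<Longrightarrow> (k - \<delta>) * card V \<le> real k * m \<Longrightarrow> card (sumset_pairs U V {} m) \<le> b"
  shows "card {(A, B). A \<subseteq> Y \<and> B \<subseteq> Y \<and> card (A <#> B) \<le> m \<and> k \<le> card A \<and> k \<le> card B}
    \<le> 9 * real n powr (2 * real k + (real m - k) / \<delta>) * b"
    (is "real (card ?\<F>) \<le> _")
proof -
  \<comment> \<open>Tagging by the sum type lets a single greedy cover handle translates by elements
    of \<open>A\<close> and of \<open>B\<close>.\<close>
  define S where "S F F' z = (case z of Inl a \<Rightarrow> (\<lambda>f. f \<otimes> a) ` F' | Inr b \<Rightarrow> (\<lambda>f. f \<otimes> b) ` F)"
    for F F' :: "'a set" and z
  define Q where "Q F F' Z = (F <#> F') \<union> (\<Union>z\<in>Z. S F F' z)" for F F' Z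
  define C where "C F Q = {y \<in> Y. card {f \<in> F. f \<otimes> y \<notin> Q} < \<delta>}" for F Q
  define \<K> where "\<K> = {F. F \<subseteq> Y \<and> card F = k}"
  define \<Z> where "\<Z> = {Z. Z \<subseteq> Y <+> Y \<and> card Z \<le> (real m - k) / \<delta>}"
  define I where "I = {(F, F', Z) \<in> \<K> \<times> \<K> \<times> \<Z>. card (Q F F' Z) \<le> m}"
  define sp where "sp = (\<lambda>(F, F', Z). sumset_pairs (C F' (Q F F' Z)) (C F (Q F F' Z)) {} m)"
  have "finite \<K>" by (rule finite_subset[of _ "Pow Y"]) (use Y(1) in \<open>auto simp: \<K>_def\<close>)
  moreover have "finite \<Z>"
    by (rule finite_subset[of _ "Pow (Y <+> Y)"]) (use Y(1) in \<open>auto simp: \<Z>_def\<close>)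
  ultimately have finI: "finite (\<K> \<times> \<K> \<times> \<Z>)" by simp
  then have "finite I" by (rule rev_finite_subset) (auto simp: I_def)
  have cover: "?\<F> \<subseteq> (\<Union>i\<in>I. sp i)"
  proof clarify
    fix A B assume AB: "A \<subseteq> Y" "B \<subseteq> Y" "card (A <#> B) \<le> m" "k \<le> card A" "k \<le> card B"
    have fAB: "finite A" "finite B" "A \<subseteq> carrier G" "B \<subseteq> carrier G" using AB Y by (auto intro: finite_subset)
    obtain F where F: "F \<subseteq> A" "card F = k" using AB obtain_subset_with_card_n by metis
    obtain F' where F': "F' \<subseteq> B" "card F' = k" using AB obtain_subset_with_card_n by metis
    have fF: "finite F" "F \<subseteq> carrier G" "finite F'" "F' \<subseteq> carrier G" "F' \<noteq> {}"
      using F F' fAB \<open>k > 0\<close> by (auto intro: finite_subset)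
    have finS: "finite (S F F' z)" for z unfolding S_def using fF by (cases z) auto
    obtain Z where Z: "Z \<subseteq> A <+> B"
      "\<delta> * card Z \<le> real (card (Q F F' Z)) - real (card (F <#> F'))"
      "\<And>z. z \<in> A <+> B \<Longrightarrow> real (card (S F F' z - Q F F' Z)) < \<delta>"
      using greedy_cover[of "A <+> B" "S F F'" "F <#> F'" \<delta>] finS fAB fF finite_set_mult \<open>\<delta> > 0\<close>
      unfolding Q_def by (metis finite_Plus)
    have "S F F' z \<subseteq> A <#> B" if "z \<in> A <+> B" for z
      using that
    proof (rule PlusE)
      fix a assume a: "a \<in> A" "z = Inl a"
      have "f \<otimes> a = a \<otimes> f" if "f \<in> F'" for f using that a fF fAB m_comm by blast
      then show ?thesis unfolding S_def using a F' by (auto intro!: set_mult_memI)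
    next
      fix b assume "b \<in> B" "z = Inr b"
      then show ?thesis unfolding S_def using F by (auto intro!: set_mult_memI)
    qed
    then have "Q F F' Z \<subseteq> A <#> B"
      unfolding Q_def using Z(1) mono_set_mult[OF F(1) F'(1), of G] by blast
    then have Qm: "card (Q F F' Z) \<le> m"
      using card_mono[OF finite_set_mult[OF fAB(1,2)]] AB(3) order_trans by blast
    \<comment> \<open>The cover starts from a set with at least \<open>k\<close> elements, so only
      \<open>m - k\<close> further elements can be gained.\<close>
    have "k \<le> card (F <#> F')" using card_le_card_set_mult[of F F'] fF F by simp
    then have "\<delta> * card Z \<le> real m - k" using Z(2) Qm by linarith
    then have "card Z \<le> (real m - k) / \<delta>" using \<open>\<delta> > 0\<close> by (simp add: field_simps)
    moreover have "Z \<subseteq> Y <+> Y" using Z(1) AB by blast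
    ultimately have I: "(F, F', Z) \<in> I"
      unfolding I_def \<K>_def \<Z>_def using F F' AB Qm by auto
    have "A \<subseteq> C F' (Q F F' Z)"
    proof
      fix a assume a: "a \<in> A"
      then have "real (card ((\<lambda>f. f \<otimes> a) ` F' - Q F F' Z)) < \<delta>" using Z(3)[of "Inl a"] unfolding S_def by auto
      then show "a \<in> C F' (Q F F' Z)"
        unfolding C_def using a AB fF fAB by (auto simp: card_translate_diff subset_iff)
    qed
    moreover have "B \<subseteq> C F (Q F F' Z)"
    proof
      fix b assume b: "b \<in> B"
      then have "real (card ((\<lambda>f. f \<otimes> b) ` F - Q F F' Z)) < \<delta>" using Z(3)[of "Inr b"] unfolding S_def by auto
      then show "b \<in> C F (Q F F' Z)"
        unfolding C_def using b AB fF fAB by (auto simp: card_translate_diff subset_iff)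
    qed
    ultimately have "(A, B) \<in> sp (F, F', Z)" unfolding sp_def sumset_pairs_def using AB by auto
    then show "(A, B) \<in> (\<Union>i\<in>I. sp i)" using I by blast
  qed
  have CY: "C F Q \<subseteq> Y" for F Q unfolding C_def by auto
  have sp_bound: "card (sp i) \<le> b" if "i \<in> I" for i
  proof -
    obtain F F' Z where i: "i = (F, F', Z)" by (cases i)
    then have FF: "F \<subseteq> Y" "card F = k" "F' \<subseteq> Y" "card F' = k" "card (Q F F' Z) \<le> m" "Z \<subseteq> Y <+> Y"
      using that unfolding I_def \<K>_def \<Z>_def by auto
    have fF: "finite F" "finite F'" "F \<subseteq> carrier G" "F' \<subseteq> carrier G" "finite Z"
      using FF Y by (auto intro: finite_subset)
    then have fQ: "finite (Q F F' Z)"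
      unfolding Q_def S_def using finite_set_mult by (auto split: sum.splits)
    have "real k * card (Q F F' Z) \<le> real k * m"
      using FF(5) by (intro mult_left_mono) auto
    then have "(k - \<delta>) * card (C F (Q F F' Z)) \<le> real k * m" "(k - \<delta>) * card (C F' (Q F F' Z)) \<le> real k * m"
      using card_container_le[OF Y(1,2) fF(1,3) fQ, of \<delta>] card_container_le[OF Y(1,2) fF(2,4) fQ, of \<delta>] FF
      unfolding C_def by auto
    then show ?thesis unfolding sp_def i using bound CY by simp
  qed
  have "b \<ge> 0"
    using bound[of "{}" "{}"] by (metis card.empty empty_subsetI mult_zero_right of_nat_0 of_nat_0_le_iff of_nat_mult order_trans)
  have "finite (sp i)" if "i \<in> I" for i
    using finite_subset[OF sumset_pairs_subset] CY Y(1) unfolding sp_def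
    by (auto split: prod.splits) (meson finite_Pow_iff finite_SigmaI finite_subset)
  then have "card ?\<F> \<le> card (\<Union>i\<in>I. sp i)" using \<open>finite I\<close> by (intro card_mono cover) auto
  also have "\<dots> \<le> (\<Sum>i\<in>I. card (sp i))" by (rule card_UN_le[OF \<open>finite I\<close>])
  finally have "real (card ?\<F>) \<le> (\<Sum>i\<in>I. real (card (sp i)))" by (simp flip: of_nat_sum)
  also have "\<dots> \<le> card I * b" using sp_bound by (intro sum_bounded_above) auto
  also have "\<dots> \<le> 9 * real n powr (2 * real k + (real m - k) / \<delta>) * b"
  proof (intro mult_right_mono \<open>b \<ge> 0\<close>)
    have "card I \<le> card (\<K> \<times> \<K> \<times> \<Z>)" using finI by (intro card_mono) (auto simp: I_def)
    then have "real (card I) \<le> real (card \<K>) * (real (card \<K>) * real (card \<Z>))"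
      by (simp add: card_cartesian_product flip: of_nat_mult)
    also have "\<dots> \<le> real n powr k * (real n powr k * (9 * real n powr ((real m - k) / \<delta>)))"
    proof -
      have "real (card \<K>) \<le> real (n ^ k)"
        unfolding \<K>_def using card_subsets_of_card_le_power[OF Y(1), of k] Y(3) by (simp only: of_nat_le_iff)
      then have K: "real (card \<K>) \<le> real n powr k" using \<open>n > 0\<close> by (simp add: powr_realpow)
      \<comment> \<open>The constant 9 bounds \<open>exp 2\<close>: the index set
        \<open>Y <+> Y\<close> has \<open>2 * n\<close> elements.\<close>
      have "exp (2::real) = exp 1 * exp 1" by (simp flip: exp_add)
      also have "\<dots> \<le> 3 * 3" using exp_le by (intro mult_mono) auto
      finally have "exp (2::real) \<le> 9" by simp
      moreover have "card (Y <+> Y) / n = (2::real)" using Y \<open>n > 0\<close> by (simp add: card_Plus)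
      ultimately have "exp (card (Y <+> Y) / n) * real n powr ((real m - k) / \<delta>)
          \<le> 9 * real n powr ((real m - k) / \<delta>)"
        by (intro mult_right_mono) auto
      then have "real (card \<Z>) \<le> 9 * real n powr ((real m - k) / \<delta>)"
        unfolding \<Z>_def using Y \<open>n > 0\<close>
        by (intro order_trans[OF card_subsets_of_card_le_powr[of "Y <+> Y" n]]) auto
      then show ?thesis using K by (intro mult_mono) auto
    qed
    also have "\<dots> = 9 * real n powr (real k + (real k + (real m - k) / \<delta>))"
      by (simp only: powr_add mult_ac)
    also have "real k + (real k + (real m - k) / \<delta>) = 2 * real k + (real m - k) / \<delta>" by simp
    finally show "real (card I) \<le> 9 * real n powr (2 * real k + (real m - k) / \<delta>)" .
  qed
  finally show ?thesis .
qed

end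

section \<open>Elementary estimates for square roots and binomial sums\<close>

lemma ceiling_sqrt_bounds:
  fixes m :: nat
  assumes "m > 0"
  defines "k \<equiv> nat \<lceil>sqrt m\<rceil>"
  shows "k > 0" and "sqrt m \<le> k" and "k < sqrt m + 1" and "m / k \<le> sqrt m"
proof -
  have "sqrt m \<ge> 1" using assms(1) by simp
  then show "sqrt m \<le> k" "k < sqrt m + 1" "k > 0" unfolding k_def by linarith+
  then have "sqrt m * sqrt m \<le> sqrt m * k" by (intro mult_left_mono) auto
  then show "m / k \<le> sqrt m" using \<open>k > 0\<close> by (simp add: field_simps)
qed

lemma card_small_subsets_le_binom_le:
  assumes "finite Y"
  shows "card {B. B \<subseteq> Y \<and> card B \<le> m} \<le> binom_le (card Y) m"
proof -
  have "{B. B \<subseteq> Y \<and> card B \<le> m} = (\<Union>k\<in>{0..m}. {B. B \<subseteq> Y \<and> card B = k})" by auto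
  also have "card \<dots> \<le> (\<Sum>k\<in>{0..m}. card {B. B \<subseteq> Y \<and> card B = k})" by (rule card_UN_le) simp
  finally show ?thesis unfolding binom_le_def using n_subsets[OF assms] by simp
qed

text \<open>Since \<open>n / m\<close> is at least 16, the binomial sum dominates the factor left by
  two containers of size \<open>2 * m\<close>.\<close>

lemma powr_16_le_binom_le:
  assumes "m > 0" and "16 * m \<le> n"
  shows "2 powr (4 * real m) \<le> binom_le n m"
proof -
  have "2 powr (4 * real m) = ((2::real) powr 4) powr real m" by (simp only: powr_powr)
  also have "\<dots> = 16 ^ m" by (simp add: powr_realpow)
  also have "\<dots> \<le> (real n / real m) ^ m" using assms by (intro power_mono) (auto simp: field_simps)
  also have "\<dots> \<le> real (n choose m)" using assms by (intro binomial_ge_n_over_k_pow_k) auto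
  also have "\<dots> \<le> binom_le n m" unfolding binom_le_def of_nat_le_iff by (intro member_le_sum) auto
  finally show ?thesis .
qed

section \<open>Crude and fine bounds for pairs of large sets\<close>

context comm_group
begin

definition large_pairs :: "'a set \<Rightarrow> nat \<Rightarrow> nat \<Rightarrow> ('a set \<times> 'a set) set" where
  "large_pairs Y m k = {(A, B). A \<subseteq> Y \<and> B \<subseteq> Y \<and> card (A <#> B) \<le> m \<and> k \<le> card A \<and> k \<le> card B}"

text \<open>With \<open>\<delta>\<close> equal to \<open>k / 2\<close> both containers have size at
  most \<open>2 * m\<close>, and all their subsets are counted. The term -2 in the exponent is kept
  for the case \<open>m = 1\<close> of the final theorem.\<close>

lemma card_large_pairs_crude:
  fixes m n :: nat
  assumes Y: "finite Y" "Y \<subseteq> carrier G" "card Y = n" and "n > 0" and "k > 0"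
  shows "card (large_pairs Y m k) \<le> 9 * real n powr (2 * real k + 2 * (m / k) - 2) * 2 powr (4 * real m)"
proof -
  have "card (large_pairs Y m k) \<le> 9 * real n powr (2 * real k + (real m - k) / (k / 2)) * 2 powr (4 * real m)"
    unfolding large_pairs_def
  proof (rule card_large_sumset_pairs_le[OF Y])
    fix U V assume UV: "U \<subseteq> Y" "V \<subseteq> Y" "(real k - k / 2) * card U \<le> real k * m"
      "(real k - k / 2) * card V \<le> real k * m"
    have "real k * card U \<le> real k * (2 * m)" "real k * card V \<le> real k * (2 * m)" using UV by auto
    then have "card U \<le> 2 * m" "card V \<le> 2 * m"
      using \<open>k > 0\<close> by (auto simp flip: of_nat_mult)
    then have le: "card U + card V \<le> 4 * m" by simp
    have "card (sumset_pairs U V {} m) \<le> (2::nat) ^ (card U + card V)"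
      using UV Y by (intro card_sumset_pairs_trivial) (auto intro: finite_subset)
    also have "\<dots> \<le> 2 ^ (4 * m)" using le by (intro power_increasing) auto
    finally have "real (card (sumset_pairs U V {} m)) \<le> real (2 ^ (4 * m))" by (simp only: of_nat_le_iff)
    then show "card (sumset_pairs U V {} m) \<le> 2 powr (4 * real m)" by (simp flip: powr_realpow)
  qed (use assms in auto)
  also have "2 * real k + (real m - k) / (k / 2) = 2 * real k + 2 * (m / k) - 2"
    using \<open>k > 0\<close> by (simp add: field_simps)
  finally show ?thesis .
qed

text \<open>With \<open>\<delta>\<close> equal to \<open>\<epsilon> * k / 2\<close> each container
  has size at most (1 + \<epsilon>) m; refinement then reduces their total size to \<open>T\<close>.
  The relation between \<open>\<epsilon>\<close> and \<open>n\<close> turns the recording cost into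
  a multiple of \<epsilon> m bits.\<close>

lemma card_large_pairs_fine:
  fixes m n :: nat and \<epsilon> \<beta> :: real
  assumes Y: "finite Y" "Y \<subseteq> carrier G" "card Y = n" and "n \<ge> 16" and "m > 0"
    and \<epsilon>: "0 < \<epsilon>" "\<epsilon> \<le> 1 / 1024" "\<epsilon> ^ 3 * sqrt m = log 2 n" and "\<beta> \<ge> 0"
    and \<beta>: "\<And>H. subgroup H G \<Longrightarrow> finite H \<Longrightarrow> real (card H) \<le> m + \<epsilon> * m \<Longrightarrow> real (card H) \<le> \<beta>"
  shows "card (large_pairs Y m (nat \<lceil>sqrt m\<rceil>)) \<le> 2 powr ((1 + 2 ^ 13 * \<epsilon>) * (m + \<beta>))"
proof -
  define s where "s = sqrt m"
  define k where "k = nat \<lceil>s\<rceil>"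
  define M where "M = m + \<epsilon> * m"
  \<comment> \<open>Chosen so that \<open>2 * M * d\<close> is at most half the square of \<epsilon>
    m, the number of outside pairs that the Kneser-type bound supplies.\<close>
  define d where "d = \<epsilon>\<^sup>2 * m / 8"
  define T where "T = (1 + 2 * \<epsilon>) * (m + \<beta>)"
  define b where "b = real n powr (192 * s / \<epsilon>\<^sup>2) * 2 powr T"
  note k = ceiling_sqrt_bounds[OF \<open>m > 0\<close>, folded s_def, folded k_def]
  have m: "real m = s * s" unfolding s_def by simp
  have s1: "s \<ge> 1" unfolding s_def using \<open>m > 0\<close> by simp
  have "log 2 n \<ge> 4" using \<open>n \<ge> 16\<close> by (simp add: le_log_iff)
  \<comment> \<open>Dividing out one \<open>\<epsilon>\<close> at a time shows that \<open>s\<close>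
    is large, so that roundings and additive constants are harmless.\<close>
  then have e3: "4 \<le> \<epsilon> ^ 3 * s" using \<epsilon> unfolding s_def by simp
  have "\<epsilon> ^ 3 * s \<le> \<epsilon>\<^sup>2 * s * (1 / 1024)"
    using mult_left_mono[OF \<epsilon>(2), of "\<epsilon>\<^sup>2 * s"] s1 \<epsilon>(1) by (simp add: power3_eq_cube power2_eq_square mult_ac)
  then have e2: "4096 \<le> \<epsilon>\<^sup>2 * s" using e3 by simp
  have "\<epsilon>\<^sup>2 * s \<le> \<epsilon> * s * (1 / 1024)"
    using mult_left_mono[OF \<epsilon>(2), of "\<epsilon> * s"] s1 \<epsilon> by (simp add: power2_eq_square mult_ac)
  then have e1: "4096 \<le> \<epsilon> * s" using e2 by simp
  have "\<epsilon> * s \<le> 1 * s" using \<epsilon> s1 by (intro mult_right_mono) auto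
  then have s: "s \<ge> 4096" using e1 by simp
  have em: "\<epsilon> * m \<ge> 4" unfolding m using e1 s mult_mono[of 4 "\<epsilon> * s" 1 s] by (simp add: mult_ac)
  have M0: "M > 0" "M \<le> 2 * m" unfolding M_def using \<epsilon> \<open>m > 0\<close> by (auto intro: add_pos_nonneg)
  have d0: "d > 0" unfolding d_def using \<epsilon> \<open>m > 0\<close> by simp
  have d512: "512 * s \<le> d"
    unfolding d_def m using mult_right_mono[OF e2, of s] s by (simp add: mult_ac)
  have kd: "2 * real k \<le> d" using k s d512 by linarith
  have many: "2 * M * d \<le> card {(u, v). u \<in> U \<and> v \<in> V \<and> u \<otimes> v \<notin> P}"
    if UVP: "U \<subseteq> Y" "V \<subseteq> Y" "finite P" "card P \<le> m" "card U \<le> M" "card V \<le> M"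
      "T < real (card U) + real (card V)" for U V P
  proof -
    \<comment> \<open>Level \<open>t\<close> is available: the total size exceeds m + 2 \<epsilon> m
      and each set has at most \<open>M\<close> elements, so each has more than \<epsilon> m.
      Moreover \<open>M - card P\<close> is at least \<epsilon> m.\<close>
    define t where "t = nat \<lfloor>\<epsilon> * m\<rfloor>"
    have t: "t \<le> \<epsilon> * m" "\<epsilon> * m / 2 \<le> t" unfolding t_def using em by linarith+
    have "0 \<le> \<epsilon> * \<beta>" using \<epsilon> \<open>\<beta> \<ge> 0\<close> by simp
    then have UV: "m + \<beta> + 2 * (\<epsilon> * m) < real (card U) + real (card V)"
      using UVP(7) unfolding T_def by (simp add: algebra_simps)
    have "\<epsilon> * m * (\<epsilon> * m) / 2 \<le> t * (\<epsilon> * m)" using mult_right_mono[OF t(2), of "\<epsilon> * m"] em by simp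
    also have "\<dots> \<le> t * (M - card P)" unfolding M_def using UVP by (intro mult_left_mono) auto
    also have "\<dots> \<le> card {(u, v). u \<in> U \<and> v \<in> V \<and> u \<otimes> v \<notin> P}"
    proof (rule card_pairs_outside_ge[where \<beta> = \<beta>])
      show "t \<le> card U" "t \<le> card V" using UV UVP t \<open>\<beta> \<ge> 0\<close> unfolding M_def by linarith+
      show "M \<le> real (card U) + real (card V) - real t - \<beta>" unfolding M_def using UV t by linarith
    qed (use UVP Y \<beta> \<open>\<beta> \<ge> 0\<close> in \<open>auto intro: finite_subset simp: M_def\<close>)
    finally have "\<epsilon> * m * (\<epsilon> * m) / 2 \<le> card {(u, v). u \<in> U \<and> v \<in> V \<and> u \<otimes> v \<notin> P}" .
    moreover have "2 * M * d \<le> 2 * (2 * m) * d" using M0 d0 by (intro mult_right_mono) auto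
    moreover have "2 * (2 * m) * d = \<epsilon> * m * (\<epsilon> * m) / 2" unfolding d_def by (simp add: power2_eq_square)
    ultimately show ?thesis by linarith
  qed
  have n1: "real n \<ge> 1" using \<open>n \<ge> 16\<close> by simp
  have "card (large_pairs Y m k) \<le> 9 * real n powr (2 * real k + (real m - k) / (\<epsilon> * k / 2)) * b"
    unfolding large_pairs_def
  proof (rule card_large_sumset_pairs_le[OF Y])
    fix U V assume UV: "U \<subseteq> Y" "V \<subseteq> Y" "(real k - \<epsilon> * k / 2) * card U \<le> real k * m"
      "(real k - \<epsilon> * k / 2) * card V \<le> real k * m"
    have cM: "real c \<le> M" if "(real k - \<epsilon> * k / 2) * c \<le> real k * m" for c
    proof -
      have "real k * ((1 - \<epsilon> / 2) * c) \<le> real k * m" using that by (simp add: algebra_simps)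
      then have "(1 - \<epsilon> / 2) * c \<le> m" using k by simp
      \<comment> \<open>Equivalent to (1 - \<epsilon> / 2) (1 + \<epsilon>) \<ge> 1, which holds
        because \<epsilon> \<le> 1.\<close>
      also have "\<dots> \<le> (1 - \<epsilon> / 2) * M"
      proof -
        have "0 \<le> (\<epsilon> / 2 - \<epsilon> * \<epsilon> / 2) * m" using \<epsilon> by (intro mult_nonneg_nonneg) (auto simp: mult_le_one)
        then show ?thesis unfolding M_def by (simp add: algebra_simps)
      qed
      finally show ?thesis using \<epsilon> by simp
    qed
    have UM: "card U \<le> M" "card V \<le> M" using cM UV by auto
    have "card (sumset_pairs U V {} m) \<le>
      real n powr (2 * (real k + 1) / d * (real (card U) + real (card V) + (real m - real (card ({}::'a set))))
        + 2 * M / (k * d) * (real m - real (card ({}::'a set)))) * 2 powr T"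
      using \<open>n \<ge> 16\<close> M0 d0 k kd many UV UM by (intro card_sumset_pairs_le[OF Y]) auto
    also have "\<dots> \<le> b"
      unfolding b_def
    proof (intro mult_right_mono powr_mono)
      \<comment> \<open>Here \<open>k + 1\<close> is at most \<open>2 * s\<close>, and the initial
        potential is at most \<open>5 * m\<close> because \<open>M \<le> 2 * m\<close>.\<close>
      have "2 * (real k + 1) / d * (real (card U) + real (card V) + (real m - real (card ({}::'a set))))
          \<le> 2 * (2 * s) / d * (5 * m)"
        using k s d0 UM M0 by (intro mult_mono divide_right_mono) auto
      also have "\<dots> = 160 * s / \<epsilon>\<^sup>2" unfolding d_def using \<open>m > 0\<close> \<epsilon> by (simp add: field_simps)
      finally have 1: "2 * (real k + 1) / d * (real (card U) + real (card V) + (real m - real (card ({}::'a set))))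
          \<le> 160 * s / \<epsilon>\<^sup>2" .
      have "2 * M / (k * d) * (real m - real (card ({}::'a set))) \<le> 2 * (2 * m) / (k * d) * m"
        using M0 d0 k by (intro mult_mono divide_right_mono) auto
      also have "\<dots> = 32 * (m / k) / \<epsilon>\<^sup>2" unfolding d_def using \<open>m > 0\<close> \<epsilon> k by (simp add: field_simps)
      also have "\<dots> \<le> 32 * s / \<epsilon>\<^sup>2" using k by (intro divide_right_mono mult_left_mono) auto
      finally have "2 * M / (k * d) * (real m - real (card ({}::'a set))) \<le> 32 * s / \<epsilon>\<^sup>2" .
      moreover have "160 * s / \<epsilon>\<^sup>2 + 32 * s / \<epsilon>\<^sup>2 = 192 * s / \<epsilon>\<^sup>2" by (simp add: add_divide_distrib[symmetric])
      ultimately show "2 * (real k + 1) / d * (real (card U) + real (card V) + (real m - real (card ({}::'a set))))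
        + 2 * M / (k * d) * (real m - real (card ({}::'a set))) \<le> 192 * s / \<epsilon>\<^sup>2" using 1 by linarith
    qed (use n1 in auto)
    finally show "card (sumset_pairs U V {} m) \<le> b" .
  qed (use \<open>n \<ge> 16\<close> k \<epsilon> in auto)
  also have "\<dots> \<le> 9 * real n powr (6 * s / \<epsilon>\<^sup>2) * b"
  proof (intro mult_right_mono mult_left_mono powr_mono)
    have "(real m - k) / (\<epsilon> * k / 2) \<le> m / (\<epsilon> * k / 2)" using \<epsilon> by (intro divide_right_mono) auto
    also have "\<dots> = 2 * (m / k) / \<epsilon>" by (simp add: mult.commute)
    also have "\<dots> \<le> 2 * s / \<epsilon>" using k \<epsilon> by (intro divide_right_mono) auto
    also have "\<dots> \<le> 2 * s / \<epsilon>\<^sup>2"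
      using \<epsilon> s by (intro divide_left_mono) (auto simp: power2_eq_square mult_le_cancel_right1)
    finally have 1: "(real m - k) / (\<epsilon> * k / 2) \<le> 2 * s / \<epsilon>\<^sup>2" .
    have "4 * s \<le> 4 * s / \<epsilon>\<^sup>2" using \<epsilon> s by (simp add: field_simps power_le_one)
    then have "2 * real k \<le> 4 * s / \<epsilon>\<^sup>2" using k s by linarith
    moreover have "4 * s / \<epsilon>\<^sup>2 + 2 * s / \<epsilon>\<^sup>2 = 6 * s / \<epsilon>\<^sup>2" by (simp add: add_divide_distrib[symmetric])
    ultimately show "2 * real k + (real m - real k) / (\<epsilon> * real k / 2) \<le> 6 * s / \<epsilon>\<^sup>2" using 1 by simp
  qed (use n1 in \<open>auto simp: b_def\<close>)
  also have "\<dots> = 9 * real n powr (198 * s / \<epsilon>\<^sup>2) * 2 powr T"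
  proof -
    have "6 * s / \<epsilon>\<^sup>2 + 192 * s / \<epsilon>\<^sup>2 = 198 * s / \<epsilon>\<^sup>2" by (simp add: add_divide_distrib[symmetric])
    then show ?thesis unfolding b_def by (simp flip: powr_add)
  qed
  also have "real n powr (198 * s / \<epsilon>\<^sup>2) = 2 powr (198 * (\<epsilon> * m))"
  proof -
    have "real n = 2 powr (\<epsilon> ^ 3 * s)" using \<epsilon>(3) n1 unfolding s_def by simp
    then have "real n powr (198 * s / \<epsilon>\<^sup>2) = 2 powr (\<epsilon> ^ 3 * s * (198 * s / \<epsilon>\<^sup>2))" by (simp add: powr_powr)
    also have "\<epsilon> ^ 3 * s * (198 * s / \<epsilon>\<^sup>2) = 198 * (\<epsilon> * m)"
      unfolding m using \<epsilon> by (simp add: power3_eq_cube power2_eq_square)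
    finally show ?thesis .
  qed
  also have "9 * 2 powr (198 * (\<epsilon> * m)) * 2 powr T \<le> 2 powr (4 * (\<epsilon> * m)) * 2 powr (198 * (\<epsilon> * m)) * 2 powr T"
  proof -
    have "(9::real) \<le> 2 powr 4" by simp
    also have "\<dots> \<le> 2 powr (4 * (\<epsilon> * m))" using em by (intro powr_mono) auto
    finally show ?thesis by (intro mult_right_mono) auto
  qed
  also have "\<dots> = 2 powr (4 * (\<epsilon> * m) + 198 * (\<epsilon> * m) + T)" by (simp only: powr_add)
  also have "\<dots> \<le> 2 powr ((1 + 2 ^ 13 * \<epsilon>) * (m + \<beta>))"
  proof (intro powr_mono)
    \<comment> \<open>The coefficient of \<epsilon> m is 4 + 198 + 2 and that of \<epsilon> \<beta>
      is 2, both far below \<open>2 ^ 13\<close>.\<close>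
    have "0 \<le> \<epsilon> * \<beta>" "0 \<le> \<epsilon> * m" using \<epsilon> \<open>\<beta> \<ge> 0\<close> by auto
    then show "4 * (\<epsilon> * m) + 198 * (\<epsilon> * m) + T \<le> (1 + 2 ^ 13 * \<epsilon>) * (m + \<beta>)"
      unfolding T_def by (simp add: algebra_simps)
  qed simp
  finally show ?thesis unfolding k_def s_def .
qed

end

section \<open>The subgroup parameter and the assembly of the bounds\<close>

lemma card_subgroup_le_subgroup_beta:
  assumes "subgroup H G" and "finite H" and "real (card H) \<le> x"
  shows "card H \<le> subgroup_beta G x"
  unfolding subgroup_beta_def
proof (rule Max_ge)
  have "{card H |H. subgroup H G \<and> finite H \<and> real (card H) \<le> x} \<subseteq> {..nat \<lfloor>x\<rfloor>}"
    by (auto simp: le_nat_floor)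
  then show "finite {card H |H. subgroup H G \<and> finite H \<and> real (card H) \<le> x}"
    using finite_subset by blast
qed (use assms in auto)

theorem theorem1p7:
  fixes G :: "('a, 'b) monoid_scheme" and Y :: "'a set" and n m :: nat
  assumes "n > 0" and "m > 0"
    and "real m \<le> 2 powr (-4) * real n"
    and "comm_group G"
    and "Y \<subseteq> carrier G" and "card Y = n"
  shows "real (card (F_asym G Y m)) \<le> real n powr (6 * sqrt (real m)) * real (binom_le n m)
    \<and> (\<forall>s::nat. real s \<ge> sqrt (real m) \<longrightarrow>
         (let \<alpha> = (sqrt (real m) / log 2 (real n)) powr (1 / 2);
              \<beta> = real (subgroup_beta G (real m + \<alpha> powr (- 2 / 3) * real m))
          in real (card (F_asym_ge G Y m s)) \<le>
               (if real m \<le> (log 2 (real n))\<^sup>2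
                then real n powr ((4 + 6 * \<alpha>) * sqrt (real m))
                else 2 powr ((1 + 2 ^ 13 * \<alpha> powr (- 2 / 3)) * (real m + \<beta>)))))"
proof -
  interpret comm_group G by fact
  have finY: "finite Y" using assms card_gt_0_iff by metis
  note Y = finY \<open>Y \<subseteq> carrier G\<close> \<open>card Y = n\<close>
  have "2 powr (-4) = inverse ((2::real) powr 4)" by (rule powr_minus)
  also have "\<dots> = 1 / 16" by simp
  finally have "2 powr (-4) = (1 / 16 :: real)" .
  then have "real m \<le> 1 / 16 * real n" using assms(3) by (simp only:)
  then have mn: "16 * m \<le> n" by linarith
  then have n16: "n \<ge> 16" using \<open>m > 0\<close> by simp
  define r where "r = sqrt m"
  define k where "k = nat \<lceil>r\<rceil>"
  note k = ceiling_sqrt_bounds[OF \<open>m > 0\<close>, folded r_def, folded k_def]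
  have m: "real m = r * r" unfolding r_def by simp
  have r1: "r \<ge> 1" unfolding r_def using \<open>m > 0\<close> by simp
  define L where "L = log 2 n"
  have L4: "L \<ge> 4" unfolding L_def using n16 by (simp add: le_log_iff)
  have nL: "real n = 2 powr L" unfolding L_def using n16 by simp
  have finlarge: "finite (large_pairs Y m k)"
    by (rule finite_subset[of _ "Pow Y \<times> Pow Y"]) (use finY in \<open>auto simp: large_pairs_def\<close>)
  have crude: "card (large_pairs Y m k) \<le> 9 * real n powr (2 * real k + 2 * (m / k) - 2) * 2 powr (4 * real m)"
    using card_large_pairs_crude[OF Y] \<open>n > 0\<close> k by simp
  have "2 * real k + 2 * (m / k) - 2 \<le> 4 * r" using k by linarith
  then have "real n powr (2 * real k + 2 * (m / k) - 2) \<le> real n powr (4 * r)" using n16 by (intro powr_mono) auto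
  then have "9 * real n powr (2 * real k + 2 * (m / k) - 2) * 2 powr (4 * real m) \<le> 9 * real n powr (4 * r) * 2 powr (4 * real m)"
    by (intro mult_right_mono mult_left_mono) auto
  then have crude': "card (large_pairs Y m k) \<le> 9 * real n powr (4 * r) * 2 powr (4 * real m)"
    using crude by linarith
  have first: "card (F_asym G Y m) \<le> real n powr (6 * r) * binom_le n m"
  proof -
    \<comment> \<open>A pair outside \<open>large_pairs\<close> has one set of size at most
      \<open>r\<close>; the other has size at most \<open>m\<close>, since nonempty sets are no
      larger than their product set.\<close>
    define \<A> where "\<A> = {A. A \<subseteq> Y \<and> card A \<le> r}"
    define \<B> where "\<B> = {B. B \<subseteq> Y \<and> card B \<le> m}"
    have "F_asym G Y m \<subseteq> large_pairs Y m k \<union> (\<A> \<times> \<B> \<union> \<B> \<times> \<A>)"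
    proof (rule subrelI, rule ccontr)
      fix A B assume AB: "(A, B) \<in> F_asym G Y m"
        "(A, B) \<notin> large_pairs Y m k \<union> (\<A> \<times> \<B> \<union> \<B> \<times> \<A>)"
      then have AB': "A \<subseteq> Y" "B \<subseteq> Y" "A \<noteq> {}" "B \<noteq> {}" "card (A <#>\<^bsub>G\<^esub> B) \<le> m"
        unfolding F_asym_def by auto
      have f: "finite A" "finite B" "A \<subseteq> carrier G" "B \<subseteq> carrier G" using AB' Y by (auto intro: finite_subset)
      have "card A \<le> m" using card_le_card_set_mult[of A B] f AB' by simp
      moreover have "B <#>\<^bsub>G\<^esub> A = A <#>\<^bsub>G\<^esub> B" unfolding set_mult_def using f m_comm by blast
      then have "card B \<le> m" using card_le_card_set_mult[of B A] f AB' by simp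
      ultimately have "\<not> card A \<le> r" "\<not> card B \<le> r" using AB AB' unfolding \<A>_def \<B>_def by auto
      then have "k \<le> card A" "k \<le> card B" unfolding k_def by linarith+
      then show False using AB(2) AB' unfolding large_pairs_def by simp
    qed
    moreover have fin: "finite \<A>" "finite \<B>" unfolding \<A>_def \<B>_def using finY by auto
    ultimately have "card (F_asym G Y m) \<le> card (large_pairs Y m k \<union> (\<A> \<times> \<B> \<union> \<B> \<times> \<A>))"
      using finlarge by (intro card_mono) auto
    also have "\<dots> \<le> card (large_pairs Y m k) + (card (\<A> \<times> \<B>) + card (\<B> \<times> \<A>))"
      using card_Un_le[of "large_pairs Y m k" "\<A> \<times> \<B> \<union> \<B> \<times> \<A>"]
        card_Un_le[of "\<A> \<times> \<B>" "\<B> \<times> \<A>"] by linarith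
    finally have "card (F_asym G Y m) \<le> card (large_pairs Y m k) + 2 * (card \<A> * card \<B>)"
      by (simp add: card_cartesian_product mult.commute)
    then have "real (card (F_asym G Y m)) \<le> real (card (large_pairs Y m k) + 2 * (card \<A> * card \<B>))"
      by (simp only: of_nat_le_iff)
    also have "\<dots> = real (card (large_pairs Y m k)) + 2 * (real (card \<A>) * real (card \<B>))" by simp
    also have "\<dots> \<le> 9 * real n powr (4 * r) * binom_le n m + 2 * (3 * real n powr (4 * r) * binom_le n m)"
    proof (intro add_mono mult_left_mono mult_mono)
      have "9 * real n powr (4 * r) * 2 powr (4 * real m) \<le> 9 * real n powr (4 * r) * binom_le n m"
        using powr_16_le_binom_le[OF \<open>m > 0\<close> mn] by (intro mult_left_mono) auto
      then show "real (card (large_pairs Y m k)) \<le> 9 * real n powr (4 * r) * binom_le n m"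
        using crude' by linarith
      have "real (card \<A>) \<le> exp 1 * real n powr r"
        unfolding \<A>_def using card_subsets_of_card_le_powr[OF finY \<open>n > 0\<close>, of r] Y \<open>n > 0\<close> by simp
      also have "\<dots> \<le> 3 * real n powr (4 * r)"
        using exp_le n16 r1 by (intro mult_mono powr_mono) auto
      finally show "real (card \<A>) \<le> 3 * real n powr (4 * r)" .
      show "real (card \<B>) \<le> binom_le n m"
        unfolding \<B>_def using card_small_subsets_le_binom_le[OF finY, of m] Y by simp
    qed auto
    also have "\<dots> = 15 * (real n powr (4 * r) * binom_le n m)" by simp
    \<comment> \<open>The exponent rises from 4 r to 6 r only to absorb the constant 9 + 2 * 3 = 15,
      which is below \<open>n\<close>.\<close>
    also have "\<dots> \<le> real n powr (2 * r) * (real n powr (4 * r) * binom_le n m)"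
    proof (intro mult_right_mono)
      have "15 \<le> real n powr 1" using n16 by simp
      also have "\<dots> \<le> real n powr (2 * r)" using n16 r1 by (intro powr_mono) auto
      finally show "15 \<le> real n powr (2 * r)" .
    qed auto
    also have "\<dots> = real n powr (6 * r) * binom_le n m" by (simp flip: powr_add mult.assoc)
    finally show ?thesis .
  qed
  define \<alpha> where "\<alpha> = (r / L) powr (1 / 2)"
  define \<epsilon> where "\<epsilon> = \<alpha> powr (- 2 / 3)"
  define \<beta> where "\<beta> = real (subgroup_beta G (real m + \<epsilon> * real m))"
  have a0: "\<alpha> > 0" unfolding \<alpha>_def using r1 L4 by simp
  have a2: "\<alpha> * \<alpha> * L = r"
    unfolding \<alpha>_def powr_add[symmetric] using r1 L4 by simp
  have e0: "\<epsilon> > 0" unfolding \<epsilon>_def using a0 by simp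
  have "\<epsilon> ^ 3 = \<alpha> powr (- 2)" unfolding \<epsilon>_def using a0 by (simp add: powr_powr flip: powr_realpow)
  also have "\<dots> = 1 / (\<alpha> * \<alpha>)" using a0 by (simp add: powr_minus power2_eq_square divide_inverse)
  finally have e3: "\<epsilon> ^ 3 * r = L" using a0 by (simp flip: a2)
  have second: "card (large_pairs Y m k) \<le> (if real m \<le> L\<^sup>2 then real n powr ((4 + 6 * \<alpha>) * r)
      else 2 powr ((1 + 2 ^ 13 * \<epsilon>) * (real m + \<beta>)))"
  proof (cases "real m \<le> L\<^sup>2")
    case True
    then have "r \<le> L" unfolding r_def using L4 by (intro real_le_lsqrt) auto
    then have "\<alpha> * \<alpha> * L \<le> 1 * L" using a2 by simp
    then have "\<alpha> * \<alpha> \<le> 1" using L4 by simp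
    then have a1: "\<alpha> \<le> 1" by (simp add: power2_eq_square[symmetric] power_le_one_iff a0 less_imp_le abs_square_le_1)
    \<comment> \<open>Since \<open>m\<close> equals r \<alpha>\<alpha> L and \<alpha> \<le> 1 in
      this range. Of the six multiples of \<open>m\<close>, four come from the containers and two
      will absorb the constant 9.\<close>
    have "6 * real m \<le> L * (6 * \<alpha> * r)"
    proof -
      have "6 * r * (\<alpha> * \<alpha> * L) \<le> 6 * r * (\<alpha> * L)"
        using a0 a1 L4 r1 by (intro mult_left_mono mult_right_mono) auto
      then show ?thesis unfolding a2 m by (simp add: mult_ac)
    qed
    then have "2 powr (6 * real m) \<le> 2 powr (L * (6 * \<alpha> * r))" by simp
    also have "\<dots> = real n powr (6 * \<alpha> * r)" unfolding nL by (simp add: powr_powr)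
    finally have 6: "2 powr (6 * real m) \<le> real n powr (6 * \<alpha> * r)" .
    \<comment> \<open>For \<open>m \<ge> 2\<close> the factor \<open>2 powr (2 * real m)\<close> is
      at least 16. For \<open>m = 1\<close> it is only 4, but the exponent of \<open>n\<close> on
      the left is then 2 instead of 4.\<close>
    have "9 * real n powr (2 * real k + 2 * (m / k) - 2) \<le> real n powr (4 * r) * 2 powr (2 * real m)"
    proof (cases "m = 1")
      case True
      then have "r = 1" "k = 1" unfolding k_def r_def by auto
      have "9 * real n powr 2 \<le> (real n powr 2 * 1) * real n powr 2"
        using n16 mult_mono[of 3 "real n" 3 "real n"] by (intro mult_right_mono) (auto simp: power2_eq_square)
      also have "\<dots> = real n powr 4 * 1" by (simp flip: powr_add)
      also have "\<dots> \<le> real n powr 4 * 2 powr (2 * real m)"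
        by (intro mult_left_mono ge_one_powr_ge_zero) auto
      finally show ?thesis using True \<open>r = 1\<close> \<open>k = 1\<close> by simp
    next
      case False
      have "(9::real) \<le> 2 powr 4" by simp
      also have "\<dots> \<le> 2 powr (2 * real m)" using False \<open>m > 0\<close> by (intro powr_mono) auto
      finally have "9 * real n powr (2 * real k + 2 * (m / k) - 2) \<le> 2 powr (2 * real m) * real n powr (4 * r)"
        using \<open>real n powr (2 * real k + 2 * (m / k) - 2) \<le> real n powr (4 * r)\<close> by (intro mult_mono) auto
      then show ?thesis by (simp add: mult.commute)
    qed
    then have "9 * real n powr (2 * real k + 2 * (m / k) - 2) * 2 powr (4 * real m)
        \<le> real n powr (4 * r) * 2 powr (2 * real m) * 2 powr (4 * real m)" by (intro mult_right_mono) auto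
    also have "\<dots> = real n powr (4 * r) * 2 powr (6 * real m)" by (simp add: mult.assoc flip: powr_add)
    also have "\<dots> \<le> real n powr (4 * r) * real n powr (6 * \<alpha> * r)" using 6 by (intro mult_left_mono) auto
    also have "\<dots> = real n powr ((4 + 6 * \<alpha>) * r)" by (simp add: algebra_simps flip: powr_add)
    finally show ?thesis using crude True by simp
  next
    case False
    have "\<beta> \<ge> 0" unfolding \<beta>_def by simp
    have "card (large_pairs Y m k) \<le> 2 powr ((1 + 2 ^ 13 * \<epsilon>) * (real m + \<beta>))"
    proof (cases "\<epsilon> \<le> 1 / 1024")
      case True
      show ?thesis unfolding k_def r_def
      proof (rule card_large_pairs_fine[OF Y n16 \<open>m > 0\<close> e0 True])
        show "\<epsilon> ^ 3 * sqrt m = log 2 n" using e3 unfolding L_def r_def .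
        show "\<beta> \<ge> 0" by fact
        fix H assume "subgroup H G" "finite H" "card H \<le> m + \<epsilon> * m"
        then show "card H \<le> \<beta>" unfolding \<beta>_def using card_subgroup_le_subgroup_beta by auto
      qed
    next
      \<comment> \<open>For larger \<open>\<epsilon>\<close> the factor 1 + 2 ^ 13 \<epsilon>
        exceeds 9, and the crude bound suffices because L r \<le> m.\<close>
      case e: False
      have "L * L < r * r" using False m by (simp add: power2_eq_square)
      then have "L < r" using r1 power_less_imp_less_base[of L 2 r] by (simp add: power2_eq_square)
      have "m \<ge> 4" using \<open>L < r\<close> L4 m mult_mono[of 4 r 1 r] by simp
      have "9 * real n powr (4 * r) * 2 powr (4 * real m) \<le> 2 powr 4 * 2 powr (L * (4 * r)) * 2 powr (4 * real m)"
        unfolding nL by (intro mult_right_mono) (auto simp: powr_powr)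
      also have "\<dots> = 2 powr (4 + L * (4 * r) + 4 * real m)" by (simp only: powr_add)
      also have "\<dots> \<le> 2 powr ((1 + 2 ^ 13 * \<epsilon>) * (real m + \<beta>))"
      proof (intro powr_mono)
        have "L * r \<le> m" unfolding m using \<open>L < r\<close> r1 by (intro mult_right_mono) auto
        then have "4 + L * (4 * r) + 4 * real m \<le> 9 * real m" using \<open>m \<ge> 4\<close> by simp
        also have "\<dots> \<le> 9 * (m + \<beta>)" using \<open>\<beta> \<ge> 0\<close> by simp
        also have "\<dots> \<le> (1 + 2 ^ 13 * \<epsilon>) * (m + \<beta>)" using e \<open>\<beta> \<ge> 0\<close> by (intro mult_right_mono) auto
        finally show "4 + L * (4 * r) + 4 * real m \<le> (1 + 2 ^ 13 * \<epsilon>) * (m + \<beta>)" .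
      qed simp
      finally show ?thesis using crude' by linarith
    qed
    then show ?thesis using False by simp
  qed
  have "real (card (F_asym_ge G Y m s)) \<le> (if real m \<le> L\<^sup>2 then real n powr ((4 + 6 * \<alpha>) * r)
      else 2 powr ((1 + 2 ^ 13 * \<epsilon>) * (real m + \<beta>)))" if "r \<le> s" for s :: nat
  proof -
    have "k \<le> s" unfolding k_def using that by linarith
    then have "F_asym_ge G Y m s \<subseteq> large_pairs Y m k"
      unfolding F_asym_ge_def F_asym_def large_pairs_def by auto
    then have "card (F_asym_ge G Y m s) \<le> card (large_pairs Y m k)" using finlarge by (rule card_mono[rotated])
    then show ?thesis using second by linarith
  qed
  then show ?thesis
    using first unfolding Let_def \<beta>_def \<epsilon>_def \<alpha>_def L_def r_def by blast
qed

end
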